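(* Let $V$ be a rank one valuation domain with quotient field $K$ and valuation $v$. Let $E,F\subset K$ be two pseudo-convergent sequences, each of which is of transcendental type or of algebraic type with nonzero breadth ideal. Then the following are equivalent: (i) $E$ and $F$ are equivalent; (ii) $V_E=V_F$; (iii) $W_E=W_F$; (iv) $w_E=w_F$. Furthermore, if $E$ and $F$ are of algebraic type, the previous conditions are equivalent to the following: (v) $\mathcal{L}_E^u=\mathcal{L}_F^u$ for all extensions $u$ of $v$ to $\overline{K}$; (vi) $\mathcal{L}_E^u=\mathcal{L}_F^u$ for an extension $u$ of $v$ to $\overline{K}$.
   Context: $V$ has rank one and its value group is regarded as a subgroup of $\mathbb{R}$; $\overline{K}$ is an algebraic closure of $K$. A sequence $E=\{s_n\}_{n\in\mathbb{N}}$ in $K$ is pseudo-convergent if $v(s_{n+1}-s_n)<v(s_{n+2}-s_{n+1})$ for all $n$. Its breadth is $\delta_E=\lim_{n\to\infty}v(s_{n+1}-s_n)\in\mathbb{R}\cup\{\infty\}$, and its breadth ideal is $\mathrm{Br}(E)=\{b\in K\mid v(b)>v(s_{n+1}-s_n)\ \forall n\in\mathbb{N}\}$. $E$ is of transcendental type if $v(f(s_n))$ is eventually constant for every $f\in K[X]$, and of algebraic type if $v(f(s_n))$ is eventually strictly increasing for some $f\in K[X]$. Two pseudo-convergent sequences $E=\{s_n\}_{n\in\mathbb{N}}$ and $F=\{t_n\}_{n\in\mathbb{N}}$ in $K$ are equivalent if $\delta_E=\delta_F$ and, for every $k\in\mathbb{N}$, there are $i_0,j_0\in\mathbb{N}$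 such that $v(s_i-t_j)>v(t_{k+1}-t_k)$ whenever $i\geq i_0$ and $j\geq j_0$. $V_E=\{\phi\in K(X)\mid \phi(s_n)\in V\text{ for all but finitely many }n\in\mathbb{N}\}$, a valuation domain of $K(X)$ lying over $V$. The map $w_E(\phi)=\lim_{n\to\infty}v(\phi(s_n))$ is, for the sequences considered, a rank one valuation $K(X)\to\mathbb{R}\cup\{\infty\}$ extending $v$, and $W_E=\{\phi\in K(X)\mid w_E(\phi)\geq 0\}$ is its valuation domain. For an extension $u$ of $v$ to $\overline{K}$, $\mathcal{L}_E^u$ is the set of pseudo-limits of $E$ in $\overline{K}$ with respect to $u$, i.e. of the $\alpha\in\overline{K}$ with $u(\alpha-s_n)<u(\alpha-s_{n+1})$ for all $n$. *)

theory Defs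
  imports
    "HOL-Library.Extended_Real"
    "HOL-Computational_Algebra.Polynomial"
    "HOL-Computational_Algebra.Fraction_Field"
    "HOL-Algebra.Algebraic_Closure_Type"
begin

section \<open>Valuations\<close>

text \<open>Valuations are written additively and take values in \<open>\<real> \<union> {\<infinity>}\<close>; as the type
  \<^typ>\<open>ereal\<close> also contains \<open>-\<infinity>\<close>, that value is excluded.\<close>

definition real_valuation :: "('a::field \<Rightarrow> ereal) \<Rightarrow> bool" where
  "real_valuation v \<longleftrightarrow>
     (\<forall>x. v x \<noteq> -\<infinity>) \<and>
     (\<forall>x. v x = \<infinity> \<longleftrightarrow> x = 0) \<and>
     (\<forall>x y. v (x * y) = v x + v y) \<and>
     (\<forall>x y. min (v x) (v y) \<le> v (x + y))"

text \<open>The value group of a \<open>real_valuation\<close> is a subgroup of \<open>\<real>\<close>,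
  so the valuation has rank one exactly when this group is nonzero.\<close>

definition rank_one_valuation :: "('a::field \<Rightarrow> ereal) \<Rightarrow> bool" where
  "rank_one_valuation v \<longleftrightarrow> real_valuation v \<and> (\<exists>x. x \<noteq> 0 \<and> v x \<noteq> 0)"

definition valuation_domain :: "('a::field \<Rightarrow> ereal) \<Rightarrow> 'a set" where
  "valuation_domain v = {x. 0 \<le> v x}"

text \<open>An extension of a rank one valuation to the algebraic closure again has rank one, and its
  value group embeds uniquely into \<open>\<real>\<close> over the value group of \<open>v\<close>; hence real-valued
  extensions are all extensions, up to equivalence.\<close>

definition extends_to_ac :: "('a::field \<Rightarrow> ereal) \<Rightarrow> ('a alg_closure \<Rightarrow> ereal) \<Rightarrow> bool" where
  "extends_to_ac v u \<longleftrightarrow> real_valuation u \<and> (\<forall>x. u (to_ac x) = v x)"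


section \<open>Pseudo-convergent sequences\<close>

definition pseudo_convergent :: "('a::field \<Rightarrow> ereal) \<Rightarrow> (nat \<Rightarrow> 'a) \<Rightarrow> bool" where
  "pseudo_convergent v s \<longleftrightarrow>
     (\<forall>n. v (s (n + 1) - s n) < v (s (n + 2) - s (n + 1)))"

definition breadth :: "('a::field \<Rightarrow> ereal) \<Rightarrow> (nat \<Rightarrow> 'a) \<Rightarrow> ereal" where
  "breadth v s = lim (\<lambda>n. v (s (n + 1) - s n))"

definition breadth_ideal :: "('a::field \<Rightarrow> ereal) \<Rightarrow> (nat \<Rightarrow> 'a) \<Rightarrow> 'a set" where
  "breadth_ideal v s = {b. \<forall>n. v b > v (s (n + 1) - s n)}"

definition transcendental_type :: "('a::field \<Rightarrow> ereal) \<Rightarrow> (nat \<Rightarrow> 'a) \<Rightarrow> bool" where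
  "transcendental_type v s \<longleftrightarrow>
     (\<forall>f :: 'a poly. \<exists>N. \<forall>n\<ge>N. v (poly f (s n)) = v (poly f (s N)))"

definition algebraic_type :: "('a::field \<Rightarrow> ereal) \<Rightarrow> (nat \<Rightarrow> 'a) \<Rightarrow> bool" where
  "algebraic_type v s \<longleftrightarrow>
     (\<exists>f :: 'a poly. \<exists>N. \<forall>n\<ge>N. v (poly f (s n)) < v (poly f (s (n + 1))))"

definition equivalent_seqs :: "('a::field \<Rightarrow> ereal) \<Rightarrow> (nat \<Rightarrow> 'a) \<Rightarrow> (nat \<Rightarrow> 'a) \<Rightarrow> bool" where
  "equivalent_seqs v s t \<longleftrightarrow>
     breadth v s = breadth v t \<and>
     (\<forall>k. \<exists>i\<^sub>0 j\<^sub>0. \<forall>i\<ge>i\<^sub>0. \<forall>j\<ge>j\<^sub>0. v (s i - t j) > v (t (k + 1) - t k))"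

definition pseudo_limits ::
    "('a::field alg_closure \<Rightarrow> ereal) \<Rightarrow> (nat \<Rightarrow> 'a) \<Rightarrow> 'a alg_closure set" where
  "pseudo_limits u s = {\<alpha>. \<forall>n. u (\<alpha> - to_ac (s n)) < u (\<alpha> - to_ac (s (n + 1)))}"


section \<open>Valuation domains of the field of rational functions\<close>

text \<open>\<open>K(X)\<close> is the type \<^typ>\<open>'a poly fract\<close>. A rational function is defined at \<open>x\<close> if some
  representation as a fraction has a denominator not vanishing at \<open>x\<close>; its value there does not
  depend on the choice of such a representation, and is unspecified at a pole.\<close>

definition defined_at :: "'a::field poly fract \<Rightarrow> 'a \<Rightarrow> bool" where
  "defined_at \<phi> x \<longleftrightarrow> (\<exists>p q. \<phi> = Fract p q \<and> poly q x \<noteq> 0)"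

definition ratfun_eval :: "'a::field poly fract \<Rightarrow> 'a \<Rightarrow> 'a" where
  "ratfun_eval \<phi> x = (THE y. \<exists>p q. \<phi> = Fract p q \<and> poly q x \<noteq> 0 \<and> y = poly p x / poly q x)"

lemma ratfun_eval_Fract:
  assumes "poly q x \<noteq> 0"
  shows "ratfun_eval (Fract p q) x = poly p x / poly q x"
  unfolding ratfun_eval_def
proof (rule the_equality)
  show "\<exists>p' q'. Fract p q = Fract p' q' \<and> poly q' x \<noteq> 0 \<and> poly p x / poly q x = poly p' x / poly q' x"
    using assms by blast
next
  fix y
  assume "\<exists>p' q'. Fract p q = Fract p' q' \<and> poly q' x \<noteq> 0 \<and> y = poly p' x / poly q' x"
  then obtain p' q' where *: "Fract p q = Fract p' q'" "poly q' x \<noteq> 0" "y = poly p' x / poly q' x"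
    by blast
  have "q \<noteq> 0" "q' \<noteq> 0"
    using assms * by auto
  with * have "p * q' = p' * q"
    by (simp add: eq_fract)
  then have "poly p x * poly q' x = poly p' x * poly q x"
    by (metis poly_mult)
  then show "y = poly p x / poly q x"
    using assms * by (simp add: frac_eq_eq)
qed

text \<open>\<open>V\<^sub>E\<close>\<close>
definition seq_domain :: "('a::field \<Rightarrow> ereal) \<Rightarrow> (nat \<Rightarrow> 'a) \<Rightarrow> 'a poly fract set" where
  "seq_domain v s =
     {\<phi>. \<forall>\<^sub>\<infinity>n. defined_at \<phi> (s n) \<and> ratfun_eval \<phi> (s n) \<in> valuation_domain v}"

text \<open>\<open>w\<^sub>E\<close>. The terms of a pseudo-convergent sequence are pairwise distinct, so only finitely many
  of them can be poles of \<open>\<phi>\<close>, and these do not affect the limit.\<close>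
definition seq_valuation :: "('a::field \<Rightarrow> ereal) \<Rightarrow> (nat \<Rightarrow> 'a) \<Rightarrow> 'a poly fract \<Rightarrow> ereal" where
  "seq_valuation v s \<phi> = lim (\<lambda>n. v (ratfun_eval \<phi> (s n)))"

text \<open>\<open>W\<^sub>E\<close>\<close>
definition seq_valuation_domain :: "('a::field \<Rightarrow> ereal) \<Rightarrow> (nat \<Rightarrow> 'a) \<Rightarrow> 'a poly fract set" where
  "seq_valuation_domain v s = {\<phi>. 0 \<le> seq_valuation v s \<phi>}"

end

theory Submission
  imports Defs
begin

text \<open>
  Fix an extension \<open>u\<close> of \<open>v\<close> to the algebraic closure. Along a pseudo-convergent sequence
  \<open>E = (s\<^sub>n)\<close> with gaps \<open>\<gamma>\<^sub>n = v (s\<^sub>n\<^sub>+\<^sub>1 - s\<^sub>n)\<close>, the value \<open>u (s\<^sub>n - \<alpha>)\<close> equals \<open>\<gamma>\<^sub>n\<close> if \<open>\<alpha>\<close> is a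
  pseudo-limit and is eventually constant otherwise. Splitting numerator and denominator over the
  algebraic closure, \<open>v (\<phi> (s\<^sub>n))\<close> is eventually an affine function \<open>c + d \<gamma>\<^sub>n\<close> of the gaps. Equivalent
  sequences have the same pseudo-limits, the same constants and hence the same \<open>c\<close> and \<open>d\<close>, which
  determine both \<open>w\<^sub>E \<phi>\<close> and whether \<open>\<phi>\<close> belongs to \<open>V\<^sub>E\<close>. Conversely, \<open>V\<^sub>E\<close> and \<open>W\<^sub>E\<close> both lie
  between \<open>{w\<^sub>E > 0}\<close> and \<open>{w\<^sub>E \<ge> 0}\<close>, and any ring in this range determines the real valuation \<open>w\<^sub>E\<close>,
  since \<open>w\<^sub>E\<close> extends \<open>v\<close>; the values \<open>w\<^sub>E (X - t\<^sub>j)\<close> at the terms of \<open>F\<close> then give the equivalence.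

  The extension \<open>u\<close> comes from a subring of the algebraic closure that is maximal among those
  containing \<open>V\<close> but not \<open>1 / a\<close>, for some \<open>a\<close> of positive value.
\<close>

section \<open>Extending a rank one valuation to the algebraic closure\<close>

definition is_subring :: "'a::field set \<Rightarrow> bool" where
  "is_subring A \<longleftrightarrow> 0 \<in> A \<and> 1 \<in> A \<and>
     (\<forall>x\<in>A. - x \<in> A) \<and> (\<forall>x\<in>A. \<forall>y\<in>A. x + y \<in> A \<and> x * y \<in> A)"

definition adjoin :: "'a::field set \<Rightarrow> 'a \<Rightarrow> 'a set" where
  "adjoin A x = {poly p x | p. \<forall>i. coeff p i \<in> A}"

context
  fixes A :: "'a::field set"
  assumes A: "is_subring A"
begin

lemma subring_0: "0 \<in> A" and subring_1: "1 \<in> A"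
  and subring_minus: "x \<in> A \<Longrightarrow> - x \<in> A"
  and subring_add: "x \<in> A \<Longrightarrow> y \<in> A \<Longrightarrow> x + y \<in> A"
  and subring_mult: "x \<in> A \<Longrightarrow> y \<in> A \<Longrightarrow> x * y \<in> A"
  using A by (auto simp: is_subring_def)

lemma subring_diff: "x \<in> A \<Longrightarrow> y \<in> A \<Longrightarrow> x - y \<in> A"
  using subring_add[of x "- y"] subring_minus[of y] by simp

lemma subring_power: "x \<in> A \<Longrightarrow> x ^ n \<in> A"
  by (induction n) (auto intro: subring_1 subring_mult)

lemma subring_sum: "(\<And>i. i \<in> S \<Longrightarrow> f i \<in> A) \<Longrightarrow> sum f S \<in> A"
  by (induction S rule: infinite_finite_induct) (auto intro: subring_0 subring_add)

lemma adjoin_is_subring: "is_subring (adjoin A x)"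
proof -
  have "- poly p x \<in> adjoin A x" if "\<forall>i. coeff p i \<in> A" for p
    unfolding adjoin_def using that by (auto intro!: exI[of _ "- p"] subring_minus)
  moreover have "poly p x + poly q x \<in> adjoin A x \<and> poly p x * poly q x \<in> adjoin A x"
    if "\<forall>i. coeff p i \<in> A" "\<forall>i. coeff q i \<in> A" for p q
  proof
    show "poly p x + poly q x \<in> adjoin A x"
      unfolding adjoin_def using that by (auto intro!: exI[of _ "p + q"] subring_add)
    have "coeff (p * q) i \<in> A" for i
      using that by (auto simp: coeff_mult intro!: subring_sum subring_mult)
    then show "poly p x * poly q x \<in> adjoin A x"
      unfolding adjoin_def by (auto intro!: exI[of _ "p * q"])
  qed
  moreover have "0 \<in> adjoin A x"
    unfolding adjoin_def by (auto intro!: exI[of _ 0] subring_0)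
  moreover have "1 \<in> adjoin A x"
    unfolding adjoin_def by (auto intro!: exI[of _ 1] subring_0 subring_1 simp: coeff_1)
  ultimately show ?thesis
    unfolding is_subring_def by (auto simp: adjoin_def)
qed

lemma subset_adjoin: "A \<subseteq> adjoin A x"
  unfolding adjoin_def
  by (auto intro!: exI[of _ "[:_:]"] subring_0 simp: coeff_pCons split: nat.splits)

lemma self_in_adjoin: "x \<in> adjoin A x"
  unfolding adjoin_def
  by (auto intro!: exI[of _ "[:0, 1:]"] subring_0 subring_1 simp: coeff_pCons split: nat.splits)

end

section \<open>Subrings maximal among those omitting 1 / a\<close>

locale maximal_excluding =
  fixes A :: "'a::field set" and a :: 'a
  assumes A: "is_subring A" and a: "a \<in> A" and inv_a: "inverse a \<notin> A"
    and maximal: "\<And>B. is_subring B \<Longrightarrow> A \<subseteq> B \<Longrightarrow> inverse a \<notin> B \<Longrightarrow> B = A"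
begin

lemmas ring = subring_0[OF A] subring_1[OF A] subring_minus[OF A] subring_add[OF A]
  subring_mult[OF A] subring_diff[OF A] subring_power[OF A] subring_sum[OF A]

lemma a_nz: "a \<noteq> 0"
  using inv_a ring(1) by auto

lemma not_unit: "c \<in> A \<Longrightarrow> a * c \<noteq> 1"
  using inv_a by (metis inverse_unique)

lemma adjoin_outside:
  assumes "x \<notin> A"
  shows "\<exists>p. (\<forall>i. coeff p i \<in> A) \<and> a * poly p x = 1"
proof -
  have "inverse a \<in> adjoin A x"
    using maximal[OF adjoin_is_subring[OF A] subset_adjoin[OF A]] self_in_adjoin[OF A, of x] assms
    by blast
  then show ?thesis
    using a_nz by (auto simp: adjoin_def) (metis right_inverse)
qed

text \<open>Otherwise 1 / a would be a polynomial in \<open>inverse (1 - a * c)\<close>; clearing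
  denominators puts a power of \<open>1 - a * c\<close> into \<open>a A\<close>. Expanding shows
  that this power is also 1 modulo \<open>a A\<close>, so \<open>a\<close> would be a unit of
  \<open>A\<close>.\<close>

lemma one_minus_mult_unit:
  assumes c: "c \<in> A"
  shows "inverse (1 - a * c) \<in> A"
proof (rule ccontr)
  let ?y = "inverse (1 - a * c)"
  assume "?y \<notin> A"
  then obtain p where p: "\<forall>i. coeff p i \<in> A" "a * poly p ?y = 1"
    using adjoin_outside by blast
  have nz: "1 - a * c \<noteq> 0"
    using not_unit[OF c] by simp
  have pow: "\<exists>d\<in>A. (1 - a * c) ^ n = 1 - a * d" for n
  proof (induction n)
    case 0
    then show ?case using ring(1) by force
  next
    case (Suc n)
    then obtain d where "d \<in> A" "(1 - a * c) ^ n = 1 - a * d" by blast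
    then have "(1 - a * c) ^ Suc n = (1 - a * c) * (1 - a * d)"
      by simp
    also have "\<dots> = 1 - a * (c + d - a * c * d)"
      by (simp add: algebra_simps)
    finally have "(1 - a * c) ^ Suc n = 1 - a * (c + d - a * c * d)" .
    moreover have "c + d - a * c * d \<in> A"
      using c a \<open>d \<in> A\<close> ring by auto
    ultimately show ?case by blast
  qed
  define n where "n = degree p"
  define s where "s = (\<Sum>i\<le>n. coeff p i * (1 - a * c) ^ (n - i))"
  have s: "s \<in> A"
    unfolding s_def using p c a by (intro ring) auto
  have "poly p ?y * (1 - a * c) ^ n = s"
    unfolding poly_altdef n_def[symmetric] s_def sum_distrib_right
  proof (rule sum.cong)
    fix i assume "i \<in> {..n}"
    then have "(1 - a * c) ^ n = (1 - a * c) ^ i * (1 - a * c) ^ (n - i)"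
      by (simp flip: power_add)
    then show "coeff p i * ?y ^ i * (1 - a * c) ^ n = coeff p i * (1 - a * c) ^ (n - i)"
      using nz by (simp add: power_inverse)
  qed simp
  then have "(1 - a * c) ^ n = a * s"
    using p(2) by (metis mult.assoc mult_1)
  moreover obtain d where "d \<in> A" "(1 - a * c) ^ n = 1 - a * d"
    using pow by blast
  ultimately have "a * (s + d) = 1" "s + d \<in> A"
    using s ring by (auto simp: algebra_simps)
  then show False
    using not_unit by blast
qed

text \<open>Here \<open>n\<close> only bounds the degree and the leading coefficient may vanish, so
  two relations can be brought to a common \<open>n\<close>.\<close>

definition relation :: "nat \<Rightarrow> 'a \<Rightarrow> bool" where
  "relation n x \<longleftrightarrow> (\<exists>p. (\<forall>i. p i \<in> A) \<and> a * (\<Sum>i\<le>n. p i * x ^ i) = 1)"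

lemma relation_mono:
  assumes "relation m x" "m \<le> n"
  shows "relation n x"
proof -
  obtain p where p: "\<forall>i. p i \<in> A" "a * (\<Sum>i\<le>m. p i * x ^ i) = 1"
    using assms by (auto simp: relation_def)
  have "(\<Sum>i\<le>m. p i * x ^ i) = (\<Sum>i\<le>n. (if i \<le> m then p i else 0) * x ^ i)"
    using assms(2) by (intro sum.mono_neutral_cong_left) auto
  then show ?thesis
    unfolding relation_def using p ring(1)
    by (intro exI[of _ "\<lambda>i. if i \<le> m then p i else 0"]) auto
qed

lemma relation_outside: "x \<notin> A \<Longrightarrow> \<exists>n. relation n x"
  using adjoin_outside[of x] unfolding relation_def poly_altdef by blast

text \<open>The relation for \<open>1 / x\<close>, whose constant term is removed by dividing by the unit \<open>1 - a q\<^sub>0\<close>,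
  serves to rewrite the leading term of the relation for \<open>x\<close>.\<close>

lemma relation_lower:
  assumes "x \<noteq> 0" "relation (Suc n) x" "relation (Suc n) (inverse x)"
  shows "relation n x"
proof -
  obtain p where p: "\<forall>i. p i \<in> A" "a * (\<Sum>i\<le>Suc n. p i * x ^ i) = 1"
    using assms by (auto simp: relation_def)
  obtain q where q: "\<forall>i. q i \<in> A" "a * (\<Sum>i\<le>Suc n. q i * inverse x ^ i) = 1"
    using assms by (auto simp: relation_def)
  define y where "y = inverse (1 - a * q 0)"
  have y: "y \<in> A" "y * (1 - a * q 0) = 1"
    unfolding y_def using one_minus_mult_unit not_unit q by auto
  have "1 - a * q 0 = a * (\<Sum>i\<le>n. q (Suc i) * inverse x ^ Suc i)"
    using q(2) unfolding sum.atMost_Suc_shift by (simp add: algebra_simps)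
  then have "x ^ Suc n * (1 - a * q 0) = a * (\<Sum>i\<le>n. q (Suc i) * x ^ (n - i))"
    unfolding sum_distrib_left
  proof (simp only: sum_distrib_left, intro sum.cong refl)
    fix i assume "i \<in> {..n}"
    then have "x ^ Suc n = x ^ (n - i) * x ^ Suc i"
      by (simp flip: power_add)
    then show "x ^ Suc n * (a * (q (Suc i) * inverse x ^ Suc i)) = a * (q (Suc i) * x ^ (n - i))"
      using assms(1) by (simp add: power_inverse del: power_Suc)
  qed
  also have "(\<Sum>i\<le>n. q (Suc i) * x ^ (n - i)) = (\<Sum>i\<le>n. q (Suc n - i) * x ^ i)"
    by (rule sum.reindex_bij_witness[of _ "\<lambda>i. n - i" "\<lambda>i. n - i"]) (auto simp: Suc_diff_le)
  finally have "y * (x ^ Suc n * (1 - a * q 0)) = y * (a * (\<Sum>i\<le>n. q (Suc n - i) * x ^ i))"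
    by (rule arg_cong)
  moreover have "y * (x ^ Suc n * (1 - a * q 0)) = x ^ Suc n * (y * (1 - a * q 0))"
    by (rule mult.left_commute)
  ultimately have top: "x ^ Suc n = y * a * (\<Sum>i\<le>n. q (Suc n - i) * x ^ i)"
    unfolding y(2) by (simp only: mult.assoc mult_1_right)
  have "(\<Sum>i\<le>Suc n. p i * x ^ i) = (\<Sum>i\<le>n. p i * x ^ i) + p (Suc n) * x ^ Suc n"
    by simp
  also have "\<dots> = (\<Sum>i\<le>n. (p i + p (Suc n) * y * a * q (Suc n - i)) * x ^ i)"
    unfolding top by (simp add: sum_distrib_left algebra_simps sum.distrib)
  finally have "a * (\<Sum>i\<le>n. (p i + p (Suc n) * y * a * q (Suc n - i)) * x ^ i) = 1"
    using p(2) by simp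
  then show ?thesis
    unfolding relation_def using p q y a ring
    by (intro exI[of _ "\<lambda>i. p i + p (Suc n) * y * a * q (Suc n - i)"]) auto
qed

text \<open>If both were outside, each would satisfy a relation with a common bound. Lowering a
  bound for one element needs the relation for the other, so both are lowered in parallel down to
  degree 0, where \<open>a\<close> would be a unit.\<close>

lemma mem_or_inverse_mem: "x \<in> A \<or> inverse x \<in> A"
proof (rule ccontr)
  assume "\<not> (x \<in> A \<or> inverse x \<in> A)"
  then have x: "x \<notin> A" "inverse x \<notin> A" "x \<noteq> 0"
    using ring(1) by auto
  obtain n m where "relation n x" "relation m (inverse x)"
    using x relation_outside by blast
  then have "\<exists>n. relation n x \<and> relation n (inverse x)"
    by (intro exI[of _ "max n m"]) (auto intro: relation_mono)
  then obtain n where "relation n x \<and> relation n (inverse x)"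
    by blast
  then have "relation 0 x"
  proof (induction n)
    case (Suc n)
    then show ?case
      using relation_lower[of x n] relation_lower[of "inverse x" n] x(3) by simp
  qed simp
  then show False
    unfolding relation_def using not_unit by auto
qed

end

text \<open>Zorn's lemma applies: any two elements of the union of a chain lie in a common member,
  so the union is again a subring.\<close>

lemma exists_maximal_excluding:
  assumes "is_subring B" "a \<in> B" "inverse a \<notin> B"
  shows "\<exists>A. maximal_excluding A a \<and> B \<subseteq> A"
proof -
  define \<A> where "\<A> = {A. is_subring A \<and> B \<subseteq> A \<and> inverse a \<notin> A}"
  have "\<exists>M\<in>\<A>. \<forall>N\<in>\<A>. M \<subseteq> N \<longrightarrow> N = M"
  proof (rule subset_Zorn_nonempty)
    show "\<A> \<noteq> {}"
      using assms by (auto simp: \<A>_def)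
  next
    fix \<C> assume C: "\<C> \<noteq> {}" "subset.chain \<A> \<C>"
    have dir: "\<exists>M\<in>\<C>. x \<in> M \<and> y \<in> M" if xy: "x \<in> \<Union>\<C>" "y \<in> \<Union>\<C>" for x y
    proof -
      obtain M N where "M \<in> \<C>" "x \<in> M" "N \<in> \<C>" "y \<in> N"
        using xy by blast
      moreover then have "M \<subseteq> N \<or> N \<subseteq> M"
        using C(2) unfolding subset_chain_def by blast
      ultimately show ?thesis
        by blast
    qed
    have mem: "is_subring M" "B \<subseteq> M" "inverse a \<notin> M" if "M \<in> \<C>" for M
      using C that by (auto simp: subset_chain_def \<A>_def)
    have "is_subring (\<Union>\<C>)"
      unfolding is_subring_def
    proof (intro conjI ballI)
      show "0 \<in> \<Union>\<C>" "1 \<in> \<Union>\<C>"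
        using C(1) mem(1) by (auto simp: is_subring_def)
      show "- x \<in> \<Union>\<C>" if "x \<in> \<Union>\<C>" for x
        using that mem(1) by (auto simp: is_subring_def)
      show "x + y \<in> \<Union>\<C>" "x * y \<in> \<Union>\<C>" if "x \<in> \<Union>\<C>" "y \<in> \<Union>\<C>" for x y
        using dir[OF that] mem(1) unfolding is_subring_def by blast+
    qed
    moreover have "B \<subseteq> \<Union>\<C>"
      using C(1) mem(2) by blast
    ultimately show "\<Union>\<C> \<in> \<A>"
      using mem(3) by (auto simp: \<A>_def)
  qed
  then obtain M where "M \<in> \<A>" and M: "\<forall>N\<in>\<A>. M \<subseteq> N \<longrightarrow> N = M"
    by blast
  then have "is_subring M" "B \<subseteq> M" "inverse a \<notin> M"
    by (auto simp: \<A>_def)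
  moreover from this have "maximal_excluding M a"
    using assms(2) M unfolding maximal_excluding_def \<A>_def by blast
  ultimately show ?thesis
    by blast
qed

section \<open>Calculus of a real-valued valuation\<close>

locale valued_field =
  fixes v :: "'a::field \<Rightarrow> ereal"
  assumes valuation: "real_valuation v"
begin

text \<open>Real values allow linear arithmetic. As \<open>real_of_ereal\<close> sends infinity to
  0, \<open>val 0\<close> is 0, whence the nonzero side conditions below.\<close>

definition val :: "'a \<Rightarrow> real" where
  "val x = real_of_ereal (v x)"

lemma v_0 [simp]: "v 0 = \<infinity>"
  and v_eq_infinity_iff [simp]: "v x = \<infinity> \<longleftrightarrow> x = 0"
  and v_not_minus_infinity [simp]: "v x \<noteq> -\<infinity>"
  and v_mult: "v (x * y) = v x + v y"
  and v_add: "min (v x) (v y) \<le> v (x + y)"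
  using valuation by (auto simp: real_valuation_def)

lemma v_eq_val: "x \<noteq> 0 \<Longrightarrow> v x = ereal (val x)"
  unfolding val_def by (cases "v x") (use v_eq_infinity_iff[of x] v_not_minus_infinity[of x] in auto)

lemma val_mult: "x \<noteq> 0 \<Longrightarrow> y \<noteq> 0 \<Longrightarrow> val (x * y) = val x + val y"
  using v_mult[of x y] by (simp add: v_eq_val)

lemma val_1 [simp]: "val 1 = 0"
  using val_mult[of 1 1] by simp

lemma v_1 [simp]: "v 1 = 0"
  by (simp add: v_eq_val)

lemma val_power: "x \<noteq> 0 \<Longrightarrow> val (x ^ n) = real n * val x"
  by (induction n) (auto simp: val_mult algebra_simps)

lemma val_inverse: "x \<noteq> 0 \<Longrightarrow> val (inverse x) = - val x"
  using val_mult[of x "inverse x"] by simp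

lemma val_divide: "x \<noteq> 0 \<Longrightarrow> y \<noteq> 0 \<Longrightarrow> val (x / y) = val x - val y"
  by (simp add: divide_inverse val_mult val_inverse)

lemma v_minus [simp]: "v (- x) = v x"
proof (cases "x = 0")
  case False
  have "val (- 1) + val (- 1) = 0"
    using val_mult[of "- 1" "- 1"] by simp
  then show ?thesis
    using val_mult[of "- 1" x] False by (simp add: v_eq_val)
qed simp

lemma v_diff_commute: "v (x - y) = v (y - x)"
  using v_minus[of "x - y"] by simp

lemma v_add_ge: "c \<le> v x \<Longrightarrow> c \<le> v y \<Longrightarrow> c \<le> v (x + y)"
  using v_add[of x y] by (auto simp: min_def split: if_splits)

lemma v_add_gt: "c < v x \<Longrightarrow> c < v y \<Longrightarrow> c < v (x + y)"
  using v_add[of x y] by (auto simp: min_def split: if_splits)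

lemma v_diff_trans_gt: "c < v (x - y) \<Longrightarrow> c < v (y - z) \<Longrightarrow> c < v (x - z)"
  using v_add_gt[of c "x - y" "y - z"] by simp

lemma v_add_eq: "v x < v y \<Longrightarrow> v (x + y) = v x"
  using v_add[of x y] v_add[of "x + y" "- y"] by (auto simp: min_def split: if_splits)

lemma v_diff_eq: "v (x - y) < v (y - z) \<Longrightarrow> v (x - z) = v (x - y)"
  using v_add_eq[of "x - y" "y - z"] by simp

end

section \<open>Valuation rings\<close>

locale valuation_ring =
  fixes A :: "'a::field set"
  assumes A: "is_subring A" and mem_or_inverse_mem: "x \<in> A \<or> inverse x \<in> A"
begin

lemmas ring = subring_0[OF A] subring_1[OF A] subring_minus[OF A] subring_add[OF A]
  subring_mult[OF A] subring_diff[OF A] subring_power[OF A] subring_sum[OF A]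

text \<open>Before values are available, \<open>unit (x / y)\<close> expresses that nonzero
  \<open>x\<close> and \<open>y\<close> have the same value.\<close>

definition unit :: "'a \<Rightarrow> bool" where
  "unit x \<longleftrightarrow> x \<noteq> 0 \<and> x \<in> A \<and> inverse x \<in> A"

lemma unit_mult: "unit x \<Longrightarrow> unit y \<Longrightarrow> unit (x * y)"
  unfolding unit_def using ring by auto

lemma unit_inverse_iff [simp]: "unit (inverse x) \<longleftrightarrow> unit x"
  unfolding unit_def using ring by auto

lemma unit_power: "unit x \<Longrightarrow> unit (x ^ n)"
  unfolding unit_def using ring by (auto simp flip: power_inverse)

lemma unit_mult_cancel:
  assumes "unit x"
  shows "unit (x * y) \<longleftrightarrow> unit y"
proof
  assume "unit (x * y)"
  then have "unit (inverse x * (x * y))"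
    using assms unit_mult[of "inverse x" "x * y"] by simp
  moreover have "inverse x * (x * y) = y"
    using assms by (simp add: unit_def)
  ultimately show "unit y"
    by simp
qed (use assms unit_mult in blast)

text \<open>A valuation ring is local: the inverse of \<open>m / (1 + m)\<close> is
  \<open>1 / m + 1\<close>, which lies outside the ring, so the quotient itself lies inside, and
  subtracting it from 1 gives \<open>1 / (1 + m)\<close>.\<close>

lemma unit_one_plus_nonunit:
  assumes m: "m \<in> A" "\<not> unit m"
  shows "unit (1 + m)"
proof (cases "m = 0")
  case True
  then show ?thesis using ring by (simp add: unit_def)
next
  case False
  then have inv: "inverse m \<notin> A"
    using m by (simp add: unit_def)
  have nz: "1 + m \<noteq> 0"
  proof
    assume "1 + m = 0"
    then have "m = - 1" by (simp add: eq_neg_iff_add_eq_0 add.commute)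
    then show False using inv ring by simp
  qed
  have "inverse (m * inverse (1 + m)) \<notin> A"
  proof
    assume "inverse (m * inverse (1 + m)) \<in> A"
    moreover have "inverse (m * inverse (1 + m)) - 1 = inverse m"
      using False nz by (simp add: field_simps)
    ultimately show False
      using inv ring by metis
  qed
  then have "m * inverse (1 + m) \<in> A"
    using mem_or_inverse_mem by blast
  moreover have "1 - m * inverse (1 + m) = inverse (1 + m)"
    using nz by (simp add: field_simps)
  ultimately have "inverse (1 + m) \<in> A"
    using ring by metis
  then show ?thesis
    using nz m ring by (simp add: unit_def)
qed

text \<open>In terms of values: if no two summands have the same value, then the sum has the value of one
  of them.\<close>

lemma sum_unit_multiple:
  assumes "finite S" "S \<noteq> {}" "\<And>i. i \<in> S \<Longrightarrow> f i \<noteq> 0"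
    and "\<And>i j. i \<in> S \<Longrightarrow> j \<in> S \<Longrightarrow> i \<noteq> j \<Longrightarrow> \<not> unit (f i / f j)"
  shows "\<exists>k\<in>S. unit (sum f S / f k)"
  using assms
proof (induction S rule: finite_ne_induct)
  case (singleton i)
  then show ?case using ring by (simp add: unit_def)
next
  case (insert i S)
  then obtain k where k: "k \<in> S" "unit (sum f S / f k)"
    by blast
  define w where "w = sum f S / f k"
  have w: "unit w" "w \<noteq> 0" "sum f S = w * f k" and nz: "f k \<noteq> 0" "f i \<noteq> 0"
    using k insert by (auto simp: w_def unit_def)
  have sum: "sum f (insert i S) = f i + w * f k"
    using insert w by simp
  have "i \<noteq> k"
    using k insert by blast
  then have non: "\<not> unit (f i / f k)" "\<not> unit (f k / f i)"
    using insert k by auto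
  \<comment> \<open>Whichever of \<open>f i\<close> and \<open>f k\<close> has the smaller value is
    factored out; up to a unit, \<open>1 + m\<close> with a nonunit \<open>m\<close>
    remains.\<close>
  show ?case
  proof (cases "f i / f k \<in> A")
    case True
    let ?m = "inverse w * (f i / f k)"
    have "?m \<in> A"
      using True w(1) ring(5) by (simp add: unit_def del: times_divide_eq_right)
    moreover have "\<not> unit ?m"
      using w(1) non(1) unit_mult_cancel[of "inverse w" "f i / f k"] unfolding unit_inverse_iff by blast
    ultimately have "unit (1 + ?m)"
      by (rule unit_one_plus_nonunit)
    then have "unit (w * (1 + ?m))"
      using w(1) unit_mult by blast
    moreover have "w * (1 + ?m) = sum f (insert i S) / f k"
      using w nz sum by (simp add: field_simps)
    ultimately show ?thesis
      using k by auto
  next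
    case False
    let ?m = "w * (f k / f i)"
    have "f k / f i \<in> A"
      using False mem_or_inverse_mem[of "f i / f k"] by simp
    then have "?m \<in> A"
      using w(1) ring(5) by (simp add: unit_def del: times_divide_eq_right)
    moreover have "\<not> unit ?m"
      using w(1) non(2) unit_mult_cancel[of w "f k / f i"] by blast
    ultimately have "unit (1 + ?m)"
      by (rule unit_one_plus_nonunit)
    moreover have "1 + ?m = sum f (insert i S) / f i"
      using w nz sum by (simp add: field_simps)
    ultimately show ?thesis
      by auto
  qed
qed

end

sublocale maximal_excluding \<subseteq> valuation_ring A
  by unfold_locales (use A mem_or_inverse_mem in auto)

section \<open>From a valuation ring over V to an extension of v\<close>

locale dominating_ring = valued_field v + valuation_ring A
  for v :: "'k::field \<Rightarrow> ereal" and A :: "'k alg_closure set" +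
  assumes to_ac_mem_iff: "to_ac b \<in> A \<longleftrightarrow> 0 \<le> v b"
begin

lemma unit_to_ac_iff: "unit (to_ac b) \<longleftrightarrow> v b = 0"
proof (cases "b = 0")
  case False
  have "inverse (to_ac b) \<in> A \<longleftrightarrow> 0 \<le> v (inverse b)"
    by (simp flip: to_ac_mem_iff)
  then show ?thesis
    using False by (auto simp: unit_def to_ac_mem_iff v_eq_val val_inverse zero_ereal_def)
qed (simp add: unit_def)

text \<open>If \<open>x ^ n\<close> and \<open>c\<close> differ by a unit, then \<open>v c / n\<close> is the only possible value of \<open>x\<close>.\<close>

definition has_value :: "'k alg_closure \<Rightarrow> real \<Rightarrow> bool" where
  "has_value x q \<longleftrightarrow>
     (\<exists>n>0. \<exists>c. c \<noteq> 0 \<and> unit (x ^ n * inverse (to_ac c)) \<and> q = val c / real n)"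

text \<open>Two terms of an algebraic equation for \<open>x\<close> must differ by a unit.\<close>

lemma has_value_exists:
  assumes "x \<noteq> 0"
  shows "\<exists>q. has_value x q"
proof -
  obtain p :: "'k poly" where p: "p \<noteq> 0" "poly (map_poly to_ac p) x = 0"
    using alg_closure_algebraic by blast
  define S where "S = {i. i \<le> degree p \<and> coeff p i \<noteq> 0}"
  define f where "f i = to_ac (coeff p i) * x ^ i" for i
  have deg: "degree (map_poly to_ac p) = degree p"
    by (rule degree_map_poly) simp
  have "sum f {..degree p} = 0"
    using p(2) by (simp add: poly_altdef deg coeff_map_poly f_def)
  moreover have "sum f {..degree p} = sum f S"
    by (rule sum.mono_neutral_right) (auto simp: S_def f_def)
  ultimately have "\<not> unit (sum f S / f k)" for k
    by (simp add: unit_def)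
  moreover have "finite S" "S \<noteq> {}"
    using p(1) by (auto simp: S_def intro!: exI[of _ "degree p"])
  moreover have nz: "f i \<noteq> 0" if "i \<in> S" for i
    using that assms by (simp add: f_def S_def)
  ultimately obtain i j where "i \<in> S" "j \<in> S" "i \<noteq> j" "unit (f i / f j)"
    using sum_unit_multiple[of S f] by blast
  \<comment> \<open>Passing to the inverse quotient if necessary makes the exponent
    \<open>i - j\<close> positive.\<close>
  then have "\<exists>i\<in>S. \<exists>j\<in>S. j < i \<and> unit (f i / f j)"
    using unit_inverse_iff[of "f i / f j"] by (metis inverse_divide linorder_neqE_nat)
  then obtain i j where ij: "i \<in> S" "j \<in> S" "j < i" "unit (f i / f j)"
    by blast
  define c where "c = coeff p j / coeff p i"
  have "x ^ i = x ^ (i - j) * x ^ j"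
    using ij(3) by (simp flip: power_add)
  then have "f i / f j = x ^ (i - j) * inverse (to_ac c)"
    using assms ij by (simp add: f_def c_def S_def field_simps)
  then have "has_value x (val c / real (i - j))"
    unfolding has_value_def using ij by (intro exI[of _ "i - j"] conjI exI[of _ c]) (auto simp: c_def S_def)
  then show ?thesis
    by blast
qed

text \<open>Raising the two units to the powers \<open>m\<close> and \<open>n\<close> and dividing
  cancels \<open>x\<close>; what remains is \<open>d ^ n / c ^ m\<close> in \<open>K\<close>, a unit
  and hence of value 0.\<close>

lemma has_value_unique:
  assumes "has_value x q" "has_value x r"
  shows "q = r"
proof -
  obtain n c where n: "n > 0" "c \<noteq> 0" "unit (x ^ n * inverse (to_ac c))" "q = val c / real n"
    using assms(1) by (auto simp: has_value_def)
  obtain m d where m: "m > 0" "d \<noteq> 0" "unit (x ^ m * inverse (to_ac d))" "r = val d / real m"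
    using assms(2) by (auto simp: has_value_def)
  have x: "x \<noteq> 0"
    using n by (auto simp: unit_def)
  have "unit ((x ^ n * inverse (to_ac c)) ^ m * inverse ((x ^ m * inverse (to_ac d)) ^ n))"
    using n m by (intro unit_mult) (auto intro: unit_power)
  also have "(x ^ n * inverse (to_ac c)) ^ m * inverse ((x ^ m * inverse (to_ac d)) ^ n) = to_ac (d ^ n / c ^ m)"
    using n m x by (simp add: field_simps power_inverse flip: power_mult)
  finally have "v (d ^ n / c ^ m) = 0"
    by (simp only: unit_to_ac_iff)
  then have "real n * val d = real m * val c"
    using n m by (simp add: v_eq_val val_divide val_power zero_ereal_def)
  then show ?thesis
    unfolding n(4) m(4) using n(1) m(1) by (simp add: field_simps)
qed

lemma has_value_mult:
  assumes "has_value x q" "has_value y r"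
  shows "has_value (x * y) (q + r)"
proof -
  obtain n c where n: "n > 0" "c \<noteq> 0" "unit (x ^ n * inverse (to_ac c))" "q = val c / real n"
    using assms(1) by (auto simp: has_value_def)
  obtain m d where m: "m > 0" "d \<noteq> 0" "unit (y ^ m * inverse (to_ac d))" "r = val d / real m"
    using assms(2) by (auto simp: has_value_def)
  have "unit ((x ^ n * inverse (to_ac c)) ^ m * (y ^ m * inverse (to_ac d)) ^ n)"
    using unit_mult[OF unit_power[OF n(3)] unit_power[OF m(3)]] .
  also have "(x ^ n * inverse (to_ac c)) ^ m * (y ^ m * inverse (to_ac d)) ^ n
      = (x * y) ^ (n * m) * inverse (to_ac (c ^ m * d ^ n))"
    by (simp add: power_mult_distrib mult_ac power_inverse flip: power_mult)
  finally have "has_value (x * y) (val (c ^ m * d ^ n) / real (n * m))"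
    unfolding has_value_def using n m by (intro exI[of _ "n * m"] conjI exI[of _ "c ^ m * d ^ n"]) auto
  also have "val (c ^ m * d ^ n) / real (n * m) = q + r"
    using n m by (simp add: val_mult val_power field_simps)
  finally show ?thesis .
qed

lemma has_value_to_ac: "b \<noteq> 0 \<Longrightarrow> has_value (to_ac b) (val b)"
  unfolding has_value_def using ring
  by (intro exI[of _ 1] conjI exI[of _ b]) (auto simp: unit_def)

text \<open>Units do not affect membership, so \<open>c\<close> can be exchanged for
  \<open>x ^ n\<close>; a valuation ring is closed under roots, which leads from
  \<open>x ^ n\<close> to \<open>x\<close>.\<close>

lemma has_value_nonneg_iff:
  assumes "has_value x q"
  shows "0 \<le> q \<longleftrightarrow> x \<in> A"
proof -
  obtain n c where n: "n > 0" "c \<noteq> 0" and un: "unit (x ^ n * inverse (to_ac c))" and q: "q = val c / real n"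
    using assms by (auto simp: has_value_def)
  have x: "x \<noteq> 0"
    using n un by (auto simp: unit_def)
  have "0 \<le> q \<longleftrightarrow> to_ac c \<in> A"
    using n q by (simp add: to_ac_mem_iff v_eq_val zero_le_divide_iff)
  also have "\<dots> \<longleftrightarrow> x ^ n \<in> A"
  proof
    assume "to_ac c \<in> A"
    then have "(x ^ n * inverse (to_ac c)) * to_ac c \<in> A"
      using un ring(5) unfolding unit_def by blast
    then show "x ^ n \<in> A"
      using n by (simp add: mult.assoc)
  next
    assume "x ^ n \<in> A"
    then have "inverse (x ^ n * inverse (to_ac c)) * x ^ n \<in> A"
      using un ring(5) unfolding unit_def by blast
    moreover have "inverse (x ^ n * inverse (to_ac c)) * x ^ n = to_ac c"
      using x n(2) by (simp add: field_simps)
    ultimately show "to_ac c \<in> A"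
      by (simp only:)
  qed
  also have "\<dots> \<longleftrightarrow> x \<in> A"
  proof
    assume xn: "x ^ n \<in> A"
    show "x \<in> A"
    proof (rule ccontr)
      assume "x \<notin> A"
      then have "inverse x \<in> A"
        using mem_or_inverse_mem by blast
      then have "inverse x ^ (n - 1) * x ^ n \<in> A"
        using xn ring(5,7) by blast
      moreover have "x ^ n = x ^ (n - 1) * x"
        using power_minus_mult[of n x] n(1) by simp
      ultimately have "x \<in> A"
        using x by (simp add: power_inverse flip: mult.assoc)
      then show False
        using \<open>x \<notin> A\<close> by blast
    qed
  qed (rule ring(7))
  finally show ?thesis .
qed

definition extension :: "'k alg_closure \<Rightarrow> ereal" where
  "extension x = (if x = 0 then \<infinity> else ereal (THE q. has_value x q))"

lemma extension_eq:
  assumes "has_value x q"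
  shows "extension x = ereal q"
proof -
  have "x \<noteq> 0"
    using assms by (auto simp: has_value_def unit_def)
  moreover have "(THE q. has_value x q) = q"
    using assms has_value_unique by blast
  ultimately show ?thesis
    by (simp add: extension_def)
qed

lemma extension_ge_0_iff: "0 \<le> extension x \<longleftrightarrow> x \<in> A"
proof (cases "x = 0")
  case False
  then obtain q where "has_value x q"
    using has_value_exists by blast
  then show ?thesis
    using has_value_nonneg_iff extension_eq by simp
qed (use ring in \<open>simp add: extension_def\<close>)

lemma extension_mult: "extension (x * y) = extension x + extension y"
proof (cases "x = 0 \<or> y = 0")
  case False
  then obtain q r where "has_value x q" "has_value y r"
    using has_value_exists by blast
  then show ?thesis
    using extension_eq has_value_mult by simp
qed (auto simp: extension_def)

text \<open>Division by \<open>x\<close> reduces the claim to \<open>1 + y / x\<close> with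
  \<open>y / x\<close> in \<open>A\<close>, where closure under addition suffices.\<close>

lemma extension_add_aux:
  assumes "extension x \<le> extension y"
  shows "extension x \<le> extension (x + y)"
proof (cases "x = 0")
  case True
  then show ?thesis
    using assms by (auto simp: extension_def split: if_splits)
next
  case False
  then obtain q where q: "has_value x q"
    using has_value_exists by blast
  have x: "extension x = ereal q" "extension y = ereal q + extension (y / x)"
    "extension (x + y) = ereal q + extension (1 + y / x)"
    using extension_eq[OF q] extension_mult[of x "y / x"] extension_mult[of x "1 + y / x"] False
    by (simp_all add: distrib_left)
  have "0 \<le> extension (y / x)"
    using assms unfolding x by (cases "extension (y / x)") auto
  then have "0 \<le> extension (1 + y / x)"
    unfolding extension_ge_0_iff by (intro ring)
  then show ?thesis
    unfolding x by (cases "extension (1 + y / x)") auto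
qed

lemma extends_to_ac_extension: "extends_to_ac v extension"
proof -
  have "min (extension x) (extension y) \<le> extension (x + y)" for x y
    using extension_add_aux[of x y] extension_add_aux[of y x]
    by (auto simp: min_def add.commute split: if_splits)
  moreover have "extension (to_ac b) = v b" for b
    using extension_eq[OF has_value_to_ac, of b] by (cases "b = 0") (auto simp: v_eq_val extension_def)
  moreover have "extension x \<noteq> -\<infinity>" "extension x = \<infinity> \<longleftrightarrow> x = 0" for x
    by (simp_all add: extension_def)
  ultimately show ?thesis
    unfolding extends_to_ac_def real_valuation_def by (simp add: extension_mult)
qed

end

lemma rank_one_valuationE:
  assumes "rank_one_valuation v"
  obtains a where "a \<noteq> 0" "0 < v a"
proof -
  interpret valued_field v
    using assms by unfold_locales (simp add: rank_one_valuation_def)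
  obtain x where x: "x \<noteq> 0" "v x \<noteq> 0"
    using assms by (auto simp: rank_one_valuation_def)
  show ?thesis
  proof (cases "0 < v x")
    case False
    then have "0 < v (inverse x)"
      using x by (auto simp: v_eq_val val_inverse zero_ereal_def)
    then show ?thesis
      using that[of "inverse x"] x by simp
  qed (use that x in blast)
qed

theorem extends_to_ac_exists:
  assumes "rank_one_valuation v"
  shows "\<exists>u. extends_to_ac v u"
proof -
  interpret valued_field v
    using assms by unfold_locales (simp add: rank_one_valuation_def)
  obtain a where pos_a: "a \<noteq> 0" "0 < v a"
    using rank_one_valuationE[OF assms] .
  then have va: "0 < val a"
    by (simp add: v_eq_val)
  have V: "is_subring (to_ac ` valuation_domain v)"
    unfolding is_subring_def valuation_domain_def
    by (auto intro!: imageI v_add_ge simp: v_mult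
          simp flip: to_ac_0 to_ac_1 to_ac_minus to_ac_add to_ac_mult)
  have "inverse (to_ac a) \<notin> to_ac ` valuation_domain v"
    using pos_a va by (auto simp: valuation_domain_def v_eq_val val_inverse simp flip: to_ac_inverse)
  then obtain A where dom: "maximal_excluding A (to_ac a)" "to_ac ` valuation_domain v \<subseteq> A"
    using exists_maximal_excluding[OF V, of "to_ac a"] pos_a by (auto simp: valuation_domain_def)
  interpret maximal_excluding A "to_ac a"
    by (rule dom(1))
  text \<open>Here rank one enters: a ring containing \<open>V\<close> and an element \<open>b\<close> outside \<open>V\<close> contains \<open>1 / a\<close>.\<close>
  have "0 \<le> v b" if b: "to_ac b \<in> A" for b
  proof (rule ccontr)
    assume "\<not> 0 \<le> v b"
    then have b': "b \<noteq> 0"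
      by auto
    then have "val b < 0"
      using \<open>\<not> 0 \<le> v b\<close> by (simp add: v_eq_val)
    \<comment> \<open>By the archimedean property the inverse of \<open>a * b ^ n\<close> lies in
      \<open>V\<close> for some \<open>n\<close>; multiplying it by \<open>b ^ n\<close>, an element
      of \<open>A\<close>, produces 1 / a.\<close>
    then obtain n where "val a < real n * - val b"
      using reals_Archimedean3[of "- val b"] \<open>val b < 0\<close> by auto
    then have "0 \<le> v (inverse a * inverse (b ^ n))"
      using pos_a b' by (simp add: v_eq_val val_mult val_inverse val_power)
    then have "to_ac (inverse a * inverse (b ^ n)) \<in> A"
      using dom(2) by (auto simp: valuation_domain_def)
    then have "to_ac (inverse a * inverse (b ^ n)) * to_ac b ^ n \<in> A"
      using b ring(5,7) by simp
    also have "to_ac (inverse a * inverse (b ^ n)) * to_ac b ^ n = inverse (to_ac a)"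
      using b' by simp
    finally show False
      using inv_a by blast
  qed
  then interpret dominating_ring v A
    by unfold_locales (use dom(2) in \<open>auto simp: valuation_domain_def\<close>)
  show ?thesis
    using extends_to_ac_extension by blast
qed

section \<open>Values along pseudo-convergent sequences\<close>

locale pseudo_convergent_seq = valued_field v
  for v :: "'a::field \<Rightarrow> ereal" +
  fixes s :: "nat \<Rightarrow> 'a"
  assumes pseudo_convergent: "pseudo_convergent v s"
begin

definition gap :: "nat \<Rightarrow> ereal" where
  "gap n = v (s (Suc n) - s n)"

text \<open>Consecutive terms are distinct, so gaps are finite. This real copy serves the affine
  formulas, while \<open>gap\<close> is compared with the possibly infinite breadth.\<close>

definition rgap :: "nat \<Rightarrow> real" where
  "rgap n = val (s (Suc n) - s n)"

lemma gap_Suc: "gap n < gap (Suc n)"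
  using pseudo_convergent by (simp add: pseudo_convergent_def gap_def)

lemma gap_strict_mono: "m < n \<Longrightarrow> gap m < gap n"
  using gap_Suc by (rule lift_Suc_mono_less)

lemma gap_mono: "m \<le> n \<Longrightarrow> gap m \<le> gap n"
  using gap_strict_mono[of m n] by (cases "m = n") auto

lemma Suc_neq: "s (Suc n) \<noteq> s n"
  using gap_Suc[of n] by (auto simp: gap_def)

lemma gap_eq: "gap n = ereal (rgap n)"
  unfolding gap_def rgap_def using Suc_neq[of n] by (simp add: v_eq_val)

lemma rgap_strict_mono: "m < n \<Longrightarrow> rgap m < rgap n"
  using gap_strict_mono[of m n] by (simp add: gap_eq)

lemma gap_tendsto: "gap \<longlonglongrightarrow> breadth v s"
proof -
  have "incseq gap"
    by (auto simp: incseq_def gap_mono)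
  then have "gap \<longlonglongrightarrow> (SUP n. gap n)"
    by (rule LIMSEQ_SUP)
  moreover from limI[OF this] have "breadth v s = (SUP n. gap n)"
    by (simp add: breadth_def gap_def[abs_def])
  ultimately show ?thesis
    by simp
qed

lemma gap_less_breadth: "gap n < breadth v s"
proof -
  have "gap (Suc n) \<le> breadth v s"
    using gap_tendsto by (rule LIMSEQ_le_const) (auto intro: gap_mono)
  then show ?thesis
    using gap_Suc[of n] by simp
qed

lemma breadth_least: "(\<And>n. gap n \<le> c) \<Longrightarrow> breadth v s \<le> c"
  using gap_tendsto by (rule LIMSEQ_le_const2) auto

lemma less_breadthE:
  assumes "c < breadth v s"
  obtains n where "c < gap n"
  using breadth_least[of c] assms by (meson not_le)

text \<open>Passing from \<open>s m\<close> to \<open>s (Suc m)\<close> adds a difference of value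
  larger than \<open>gap n\<close>, which leaves the value unchanged.\<close>

lemma v_diff: "n < m \<Longrightarrow> v (s m - s n) = gap n"
proof (induction m)
  case (Suc m)
  show ?case
  proof (cases "n = m")
    case False
    then have n: "n < m" and IH: "v (s m - s n) = gap n"
      using Suc by auto
    have "v (s n - s (Suc m)) = v (s n - s m)"
      using IH gap_strict_mono[OF n] v_diff_eq[of "s n" "s m" "s (Suc m)"]
      by (simp add: gap_def v_diff_commute)
    then show ?thesis
      using IH by (simp add: v_diff_commute)
  qed (simp add: gap_def)
qed simp

definition pseudo_limit :: "'a \<Rightarrow> bool" where
  "pseudo_limit x \<longleftrightarrow> (\<forall>n. v (x - s n) < v (x - s (Suc n)))"

lemma pseudo_limit_iff: "pseudo_limit x \<longleftrightarrow> (\<forall>n. v (x - s n) = gap n)"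
proof
  assume "pseudo_limit x"
  then have "v (s n - x) < v (x - s (Suc n))" for n
    by (simp add: pseudo_limit_def v_diff_commute)
  then have "v (s n - s (Suc n)) = v (s n - x)" for n
    by (rule v_diff_eq)
  then show "\<forall>n. v (x - s n) = gap n"
    by (simp add: gap_def v_diff_commute)
qed (simp add: pseudo_limit_def gap_Suc)

text \<open>Some \<open>v (x - s M)\<close> differs from \<open>gap M\<close>. If it is larger, the
  next value is \<open>gap M\<close>, which is below \<open>gap (Suc M)\<close>; so some value lies
  below its gap. From there on the terms are closer to each other than to \<open>x\<close>.\<close>

lemma not_pseudo_limitE:
  assumes "\<not> pseudo_limit x"
  obtains N where "\<And>n. n \<ge> N \<Longrightarrow> v (x - s n) = v (x - s N)" "v (x - s N) < gap N"
proof -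
  obtain M where M: "v (x - s M) \<noteq> gap M"
    using assms by (auto simp: pseudo_limit_iff)
  have "\<exists>N. v (x - s N) < gap N"
  proof (cases "v (x - s M) < gap M")
    case False
    then have "v (s (Suc M) - s M) < v (s M - x)"
      using M unfolding v_diff_commute[of "s M" x] gap_def by (metis linorder_neqE)
    then have "v (s (Suc M) - x) = gap M"
      unfolding gap_def by (rule v_diff_eq)
    then show ?thesis
      using gap_Suc[of M] by (intro exI[of _ "Suc M"]) (simp add: v_diff_commute[of x])
  qed blast
  then obtain N where N: "v (x - s N) < gap N"
    by blast
  have "v (x - s n) = v (x - s N)" if "n \<ge> N" for n
  proof (cases "n = N")
    case False
    then have "v (s N - s n) = gap N"
      using v_diff[of N n] that v_diff_commute by simp
    then show ?thesis
      using N v_diff_eq[of x "s N" "s n"] by simp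
  qed simp
  then show ?thesis
    using that N by blast
qed

lemma pseudo_limit_diff_tendsto:
  "pseudo_limit x \<Longrightarrow> (\<lambda>n. v (x - s n)) \<longlonglongrightarrow> breadth v s"
  using gap_tendsto by (simp add: pseudo_limit_iff)

lemma not_pseudo_limit_self: "\<not> pseudo_limit (s n)"
  unfolding pseudo_limit_def by (auto intro!: exI[of _ n])

end

section \<open>Values along two equivalent sequences\<close>

text \<open>Equality with a finite \<open>ereal\<close> also records that zeros of the evaluated
  function are eventually avoided.\<close>

definition affine_along :: "(nat \<Rightarrow> real) \<Rightarrow> real \<Rightarrow> real \<Rightarrow> (nat \<Rightarrow> ereal) \<Rightarrow> bool" where
  "affine_along g c d w \<longleftrightarrow> (\<forall>\<^sub>F n in sequentially. w n = ereal (c + d * g n))"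

locale pseudo_convergent_pair =
  E: pseudo_convergent_seq v E + F: pseudo_convergent_seq v F
  for v :: "'a::field \<Rightarrow> ereal" and E F

locale equivalent_pair = pseudo_convergent_pair v E F
  for v :: "'a::field \<Rightarrow> ereal" and E F +
  assumes equivalent: "equivalent_seqs v E F"
begin

lemma breadth_eq: "breadth v E = breadth v F"
  using equivalent by (simp add: equivalent_seqs_def)

lemma eventually_close:
  assumes "c < breadth v F"
  obtains N where "\<And>i j. i \<ge> N \<Longrightarrow> j \<ge> N \<Longrightarrow> c < v (E i - F j)"
proof -
  obtain k where k: "c < F.gap k"
    using assms F.less_breadthE by blast
  obtain i j where ij: "\<And>i' j'. i' \<ge> i \<Longrightarrow> j' \<ge> j \<Longrightarrow> F.gap k < v (E i' - F j')"
    using equivalent by (auto simp: equivalent_seqs_def F.gap_def) metis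
  show ?thesis
  proof (rule that)
    fix i' j' assume "i' \<ge> max i j" "j' \<ge> max i j"
    then show "c < v (E i' - F j')"
      using ij[of i' j'] k by simp
  qed
qed

text \<open>The definition measures closeness by the gaps of \<open>F\<close>; as the breadths
  agree, every gap of \<open>E\<close> is exceeded by one of them.\<close>

lemma equivalent_pair_swap: "equivalent_pair v F E"
proof unfold_locales
  have "\<exists>i0 j0. \<forall>i\<ge>i0. \<forall>j\<ge>j0. E.gap k < v (F i - E j)" for k
  proof -
    obtain N where "\<And>i j. i \<ge> N \<Longrightarrow> j \<ge> N \<Longrightarrow> E.gap k < v (E i - F j)"
      using eventually_close[of "E.gap k"] E.gap_less_breadth[of k] breadth_eq by auto
    then show ?thesis
      by (metis E.v_diff_commute)
  qed
  then show "equivalent_seqs v F E"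
    by (simp add: equivalent_seqs_def breadth_eq E.gap_def)
qed

text \<open>Eventually the two sequences are closer to each other than \<open>E\<close> is to
  \<open>x\<close>, so both have the same distance from \<open>x\<close>.\<close>

lemma eventually_constant:
  assumes "\<not> E.pseudo_limit x"
  shows "\<exists>c. \<forall>\<^sub>F n in sequentially. v (E n - x) = ereal c \<and> v (F n - x) = ereal c"
proof -
  obtain N where N: "\<And>n. n \<ge> N \<Longrightarrow> v (x - E n) = v (x - E N)" "v (x - E N) < E.gap N"
    using E.not_pseudo_limitE[OF assms] by blast
  obtain M where M: "\<And>i j. i \<ge> M \<Longrightarrow> j \<ge> M \<Longrightarrow> v (x - E N) < v (E i - F j)"
    by (rule eventually_close[of "v (x - E N)"])
      (use N(2) E.gap_less_breadth[of N] breadth_eq in auto)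
  have "v (x - F j) = v (x - E N)" if "j \<ge> M" for j
    using M[of "max M N" j] N(1)[of "max M N"] that E.v_diff_eq[of x "E (max M N)" "F j"] by simp
  then have "v (E n - x) = v (x - E N) \<and> v (F n - x) = v (x - E N)" if "n \<ge> max M N" for n
    using N(1)[of n] that E.v_diff_commute[of "E n" x] E.v_diff_commute[of "F n" x] by simp
  moreover obtain c where "v (x - E N) = ereal c"
    using N(2) by (cases "v (x - E N)") auto
  ultimately have "\<forall>n\<ge>max M N. v (E n - x) = ereal c \<and> v (F n - x) = ereal c"
    by simp
  then show ?thesis
    unfolding eventually_sequentially by blast
qed

lemma not_pseudo_limit_transfer:
  assumes "\<not> E.pseudo_limit x"
  shows "\<not> F.pseudo_limit x"
proof
  assume F: "F.pseudo_limit x"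
  obtain c where "\<forall>\<^sub>F n in sequentially. v (E n - x) = ereal c \<and> v (F n - x) = ereal c"
    using eventually_constant[OF assms] by blast
  then obtain N where "\<forall>n\<ge>N. v (F n - x) = ereal c"
    by (auto simp: eventually_sequentially)
  then have "F.gap N = F.gap (Suc N)"
    using F by (metis F.pseudo_limit_iff E.v_diff_commute le_refl le_SucI)
  then show False
    using F.gap_Suc[of N] by simp
qed

lemma pseudo_limit_eq: "E.pseudo_limit x \<longleftrightarrow> F.pseudo_limit x"
  using not_pseudo_limit_transfer[of x]
    equivalent_pair.not_pseudo_limit_transfer[OF equivalent_pair_swap, of x] by blast

text \<open>Both sequences share \<open>c\<close> and \<open>d\<close>. The last clause later yields
  pseudo-limits for sequences of algebraic type.\<close>

definition jointly_affine :: "('a \<Rightarrow> 'a) \<Rightarrow> bool" where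
  "jointly_affine h \<longleftrightarrow> (\<exists>c d. affine_along E.rgap c d (\<lambda>n. v (h (E n))) \<and>
     affine_along F.rgap c d (\<lambda>n. v (h (F n))) \<and> ((\<forall>x. \<not> E.pseudo_limit x) \<longrightarrow> d = 0))"

lemma jointly_affine_const: "a \<noteq> 0 \<Longrightarrow> jointly_affine (\<lambda>_. a)"
  unfolding jointly_affine_def affine_along_def
  by (rule exI[of _ "E.val a"], rule exI[of _ 0]) (simp add: E.v_eq_val)

text \<open>A root that is a pseudo-limit contributes the gap itself, with slope 1; any other root
  contributes a constant.\<close>

lemma jointly_affine_diff: "jointly_affine (\<lambda>y. y - x)"
proof (cases "E.pseudo_limit x")
  case True
  then have "v (E n - x) = ereal (E.rgap n)" "v (F n - x) = ereal (F.rgap n)" for n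
    using pseudo_limit_eq E.pseudo_limit_iff F.pseudo_limit_iff E.gap_eq F.gap_eq E.v_diff_commute
    by metis+
  then show ?thesis
    unfolding jointly_affine_def affine_along_def using True
    by - (rule exI[of _ 0], rule exI[of _ 1], auto)
next
  case False
  then obtain c where "\<forall>\<^sub>F n in sequentially. v (E n - x) = ereal c \<and> v (F n - x) = ereal c"
    using eventually_constant by blast
  then show ?thesis
    unfolding jointly_affine_def affine_along_def
    by - (rule exI[of _ c], rule exI[of _ 0], auto elim: eventually_mono)
qed

lemma jointly_affine_mult:
  assumes "jointly_affine f" "jointly_affine h"
  shows "jointly_affine (\<lambda>x. f x * h x)"
proof -
  obtain c d c' d' where *: "affine_along E.rgap c d (\<lambda>n. v (f (E n)))"
     "affine_along F.rgap c d (\<lambda>n. v (f (F n)))" "(\<forall>x. \<not> E.pseudo_limit x) \<longrightarrow> d = 0"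
     "affine_along E.rgap c' d' (\<lambda>n. v (h (E n)))"
     "affine_along F.rgap c' d' (\<lambda>n. v (h (F n)))" "(\<forall>x. \<not> E.pseudo_limit x) \<longrightarrow> d' = 0"
    using assms unfolding jointly_affine_def by blast
  show ?thesis
    unfolding jointly_affine_def
  proof (rule exI[of _ "c + c'"], rule exI[of _ "d + d'"], intro conjI)
    show "affine_along E.rgap (c + c') (d + d') (\<lambda>n. v (f (E n) * h (E n)))"
      using *(1,4) unfolding affine_along_def
      by eventually_elim (simp add: E.v_mult algebra_simps)
    show "affine_along F.rgap (c + c') (d + d') (\<lambda>n. v (f (F n) * h (F n)))"
      using *(2,5) unfolding affine_along_def
      by eventually_elim (simp add: E.v_mult algebra_simps)
  qed (use * in auto)
qed

lemma jointly_affine_split_poly: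
  assumes "a \<noteq> 0"
  shows "jointly_affine (poly (smult a (\<Prod>x\<in>#M. [:- x, 1:])))"
proof (induction M)
  case empty
  then show ?case
    using jointly_affine_const[OF assms] by simp
next
  case (add x M)
  have "poly (smult a (\<Prod>x\<in>#add_mset x M. [:- x, 1:]))
      = (\<lambda>y. (y - x) * poly (smult a (\<Prod>x\<in>#M. [:- x, 1:])) y)"
    by (simp add: fun_eq_iff algebra_simps)
  then show ?case
    using jointly_affine_mult[OF jointly_affine_diff add.IH] by simp
qed

end

lemma jointly_affine_poly:
  fixes v :: "'a::alg_closed_field \<Rightarrow> ereal"
  assumes "equivalent_pair v E F" "p \<noteq> 0"
  shows "equivalent_pair.jointly_affine v E F (poly p)"
proof -
  interpret equivalent_pair v E F
    by (rule assms(1))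
  obtain M where M: "p = smult (lead_coeff p) (\<Prod>x\<in>#M. [:- x, 1:])"
    using alg_closed_imp_factorization[OF assms(2)] by blast
  show ?thesis
    by (subst M, rule jointly_affine_split_poly) (use assms(2) in simp)
qed

text \<open>Pairing a sequence with itself makes the results on pairs available for a single
  sequence.\<close>

lemma (in pseudo_convergent_seq) equivalent_pair_refl: "equivalent_pair v s s"
proof unfold_locales
  have "gap k < v (s i - s j)" if "i \<ge> Suc k" "j \<ge> Suc k" for i j k
    using that
  proof (induction i j rule: linorder_wlog)
    case (le i j)
    then show ?case
      using gap_strict_mono[of k i] gap_strict_mono[of k j] v_diff[of i j] gap_eq[of k]
      by (cases "i = j") (auto simp: v_diff_commute)
  qed (simp add: v_diff_commute)
  then show "equivalent_seqs v s s"
    unfolding equivalent_seqs_def gap_def Suc_eq_plus1 by blast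
qed

section \<open>Equivalence from common pseudo-limits\<close>

context pseudo_convergent_pair
begin

text \<open>Otherwise some \<open>F n\<close> is closer to \<open>x\<close> than every
  \<open>E m\<close>, hence a pseudo-limit of \<open>E\<close> and so of \<open>F\<close>; but no
  term is a pseudo-limit of its own sequence.\<close>

lemma equivalent_of_pseudo_limits_eq_aux:
  assumes eq: "\<And>x. E.pseudo_limit x \<longleftrightarrow> F.pseudo_limit x" and x: "E.pseudo_limit x"
  shows "breadth v F \<le> breadth v E"
proof (rule ccontr)
  assume "\<not> breadth v F \<le> breadth v E"
  then obtain n where n: "breadth v E < F.gap n"
    using F.less_breadthE by (metis not_le)
  have "v (E m - F n) = v (E m - x)" for m
  proof (rule E.v_diff_eq)
    have "v (E m - x) = E.gap m" "v (x - F n) = F.gap n"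
      using x eq E.v_diff_commute by (metis E.pseudo_limit_iff F.pseudo_limit_iff)+
    then show "v (E m - x) < v (x - F n)"
      using n E.gap_less_breadth[of m] by simp
  qed
  then have "E.pseudo_limit (F n)"
    using x by (simp add: E.pseudo_limit_iff E.v_diff_commute)
  then show False
    using eq F.not_pseudo_limit_self by blast
qed

text \<open>With equal breadths, late terms of both sequences are closer to the common pseudo-limit
  \<open>x\<close> than any given gap, and therefore to each other.\<close>

lemma equivalent_of_pseudo_limits_eq:
  assumes eq: "\<And>x. E.pseudo_limit x \<longleftrightarrow> F.pseudo_limit x" and x: "E.pseudo_limit x"
  shows "equivalent_seqs v E F"
proof -
  interpret swap: pseudo_convergent_pair v F E
    by unfold_locales
  have breadth: "breadth v E = breadth v F"
    using equivalent_of_pseudo_limits_eq_aux[OF eq x]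
      swap.equivalent_of_pseudo_limits_eq_aux[of x] eq x by (simp add: antisym)
  have "\<exists>i0 j0. \<forall>i\<ge>i0. \<forall>j\<ge>j0. F.gap k < v (E i - F j)" for k
  proof -
    obtain i0 where i0: "F.gap k < E.gap i0"
      using E.less_breadthE[of "F.gap k"] F.gap_less_breadth[of k] breadth by auto
    have "F.gap k < v (E i - F j)" if "i \<ge> i0" "j \<ge> Suc k" for i j
    proof (rule E.v_diff_trans_gt)
      show "F.gap k < v (E i - x)"
        using x i0 E.gap_mono[OF that(1)] by (simp add: E.pseudo_limit_iff E.v_diff_commute)
      show "F.gap k < v (x - F j)"
        using x that(2) eq F.gap_strict_mono[of k j] by (simp add: F.pseudo_limit_iff)
    qed
    then show ?thesis
      by blast
  qed
  then show ?thesis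
    by (simp add: equivalent_seqs_def breadth F.gap_def)
qed

end

section \<open>Passing between K and its algebraic closure\<close>

lemma pseudo_convergent_seq_to_ac:
  assumes "extends_to_ac v u" "pseudo_convergent_seq v s"
  shows "pseudo_convergent_seq u (\<lambda>n. to_ac (s n))"
    and "pseudo_convergent_seq.rgap u (\<lambda>n. to_ac (s n)) = pseudo_convergent_seq.rgap v s"
    and "{x. pseudo_convergent_seq.pseudo_limit u (\<lambda>n. to_ac (s n)) x} = pseudo_limits u s"
proof -
  interpret pseudo_convergent_seq v s
    by (rule assms(2))
  have ext: "real_valuation u" "u (to_ac x) = v x" for x
    using assms(1) by (auto simp: extends_to_ac_def)
  show u: "pseudo_convergent_seq u (\<lambda>n. to_ac (s n))"
    by unfold_locales
      (use ext pseudo_convergent in \<open>auto simp: pseudo_convergent_def simp flip: to_ac_diff\<close>)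
  interpret u: pseudo_convergent_seq u "\<lambda>n. to_ac (s n)"
    by (rule u)
  show "u.rgap = rgap"
    by (simp add: fun_eq_iff rgap_def u.rgap_def val_def u.val_def ext flip: to_ac_diff)
  show "{x. u.pseudo_limit x} = pseudo_limits u s"
    by (simp add: u.pseudo_limit_def pseudo_limits_def)
qed

lemma equivalent_seqs_to_ac:
  assumes "extends_to_ac v u"
  shows "equivalent_seqs u (\<lambda>n. to_ac (s n)) (\<lambda>n. to_ac (t n)) \<longleftrightarrow> equivalent_seqs v s t"
  using assms by (simp add: extends_to_ac_def equivalent_seqs_def breadth_def flip: to_ac_diff)

context pseudo_convergent_pair
begin

lemma pair_to_ac:
  assumes "extends_to_ac v u"
  shows "pseudo_convergent_pair u (\<lambda>n. to_ac (E n)) (\<lambda>n. to_ac (F n))"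
  unfolding pseudo_convergent_pair_def
  using assms E.pseudo_convergent_seq_axioms F.pseudo_convergent_seq_axioms
  by (simp add: pseudo_convergent_seq_to_ac)

lemma pseudo_limits_eq_imp_equivalent:
  assumes u: "extends_to_ac v u" and eq: "pseudo_limits u E = pseudo_limits u F"
    and ne: "pseudo_limits u E \<noteq> {}"
  shows "equivalent_seqs v E F"
proof -
  interpret u: pseudo_convergent_pair u "\<lambda>n. to_ac (E n)" "\<lambda>n. to_ac (F n)"
    using u by (rule pair_to_ac)
  have "u.E.pseudo_limit x \<longleftrightarrow> x \<in> pseudo_limits u E" "u.F.pseudo_limit x \<longleftrightarrow> x \<in> pseudo_limits u F" for x
    by (simp_all add: u.E.pseudo_limit_def u.F.pseudo_limit_def pseudo_limits_def)
  then show ?thesis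
    using u.equivalent_of_pseudo_limits_eq eq ne equivalent_seqs_to_ac[OF u] by blast
qed

end

context equivalent_pair
begin

lemma equivalent_pair_to_ac:
  assumes "extends_to_ac v u"
  shows "equivalent_pair u (\<lambda>n. to_ac (E n)) (\<lambda>n. to_ac (F n))"
  unfolding equivalent_pair_def equivalent_pair_axioms_def
  using pair_to_ac[OF assms] equivalent_seqs_to_ac[OF assms] equivalent by blast

lemma pseudo_limits_eq:
  assumes "extends_to_ac v u"
  shows "pseudo_limits u E = pseudo_limits u F"
proof -
  interpret u: equivalent_pair u "\<lambda>n. to_ac (E n)" "\<lambda>n. to_ac (F n)"
    using assms by (rule equivalent_pair_to_ac)
  show ?thesis
    using u.pseudo_limit_eq by (simp add: u.E.pseudo_limit_def u.F.pseudo_limit_def pseudo_limits_def)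
qed

text \<open>The polynomial splits over the algebraic closure; the embedding preserves values and
  gaps, so the affine formula descends to \<open>K\<close>.\<close>

lemma poly_affine:
  assumes u: "extends_to_ac v u" and p: "p \<noteq> 0"
  shows "\<exists>c d. affine_along E.rgap c d (\<lambda>n. v (poly p (E n))) \<and>
    affine_along F.rgap c d (\<lambda>n. v (poly p (F n))) \<and> (pseudo_limits u E = {} \<longrightarrow> d = 0)"
proof -
  interpret u: equivalent_pair u "\<lambda>n. to_ac (E n)" "\<lambda>n. to_ac (F n)"
    using u by (rule equivalent_pair_to_ac)
  have eq: "poly (map_poly to_ac p) (to_ac x) = to_ac (poly p x)" for x
    by (induction p) (simp_all add: map_poly_pCons)
  have "map_poly to_ac p \<noteq> 0"
    using p by (simp add: map_poly_eq_0_iff)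
  then have "u.jointly_affine (poly (map_poly to_ac p))"
    using jointly_affine_poly u.equivalent_pair_axioms by blast
  moreover have "u (to_ac x) = v x" for x
    using u by (simp add: extends_to_ac_def)
  moreover have "u.E.rgap = E.rgap" "u.F.rgap = F.rgap"
    "{x. u.E.pseudo_limit x} = pseudo_limits u E"
    using pseudo_convergent_seq_to_ac[OF u E.pseudo_convergent_seq_axioms]
      pseudo_convergent_seq_to_ac[OF u F.pseudo_convergent_seq_axioms] by auto
  ultimately show ?thesis
    unfolding u.jointly_affine_def eq by auto
qed

lemma ratfun_affine:
  assumes v: "rank_one_valuation v" and \<phi>: "\<phi> \<noteq> 0"
  shows "\<exists>c d. affine_along E.rgap c d (\<lambda>n. v (ratfun_eval \<phi> (E n))) \<and>
    affine_along F.rgap c d (\<lambda>n. v (ratfun_eval \<phi> (F n))) \<and>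
    (transcendental_type v E \<longrightarrow> d = 0)"
proof -
  obtain u where u: "extends_to_ac v u"
    using extends_to_ac_exists[OF v] by blast
  obtain p q where pq: "\<phi> = Fract p q" "q \<noteq> 0"
    by (cases \<phi>) auto
  have "p \<noteq> 0"
    using \<phi> pq by (auto simp: fract_collapse)
  then obtain c d where p: "affine_along E.rgap c d (\<lambda>n. v (poly p (E n)))"
    "affine_along F.rgap c d (\<lambda>n. v (poly p (F n)))"
    using poly_affine[OF u] by blast
  obtain c' d' where q: "affine_along E.rgap c' d' (\<lambda>n. v (poly q (E n)))"
    "affine_along F.rgap c' d' (\<lambda>n. v (poly q (F n)))"
    using poly_affine[OF u pq(2)] by blast
  have div: "v (ratfun_eval \<phi> x) = ereal (a - b)"
    if "v (poly p x) = ereal a" "v (poly q x) = ereal b" for x a b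
  proof -
    have "poly p x \<noteq> 0" "poly q x \<noteq> 0"
      using that by auto
    then show ?thesis
      using that by (simp add: pq(1) ratfun_eval_Fract E.v_eq_val E.val_divide)
  qed
  have E: "affine_along E.rgap (c - c') (d - d') (\<lambda>n. v (ratfun_eval \<phi> (E n)))"
    using p(1) q(1) unfolding affine_along_def
    by eventually_elim (simp add: div algebra_simps)
  moreover have "affine_along F.rgap (c - c') (d - d') (\<lambda>n. v (ratfun_eval \<phi> (F n)))"
    using p(2) q(2) unfolding affine_along_def
    by eventually_elim (simp add: div algebra_simps)
  moreover have "d - d' = 0" if "transcendental_type v E"
  proof -
    \<comment> \<open>Gaps increase strictly, so values that are eventually constant force slope 0,
      for numerator and denominator separately.\<close>
    have zero: "b = 0" if b: "affine_along E.rgap a b (\<lambda>n. v (poly f (E n)))" for a b f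
    proof -
      obtain N where "\<forall>n\<ge>N. v (poly f (E n)) = v (poly f (E N))"
        using \<open>transcendental_type v E\<close> by (auto simp: transcendental_type_def)
      moreover obtain M where M: "\<forall>n\<ge>M. v (poly f (E n)) = ereal (a + b * E.rgap n)"
        using b by (auto simp: affine_along_def eventually_sequentially)
      ultimately have "ereal (a + b * E.rgap (max M N)) = ereal (a + b * E.rgap (Suc (max M N)))"
        by (metis le_SucI max.cobounded1 max.cobounded2)
      then show "b = 0"
        using E.rgap_strict_mono[of "max M N" "Suc (max M N)"] by simp
    qed
    show ?thesis
      using zero[OF p(1)] zero[OF q(1)] by simp
  qed
  ultimately show ?thesis
    by blast
qed

end

section \<open>Type, breadth and limits of a single sequence\<close>

context pseudo_convergent_seq
begin

text \<open>Without pseudo-limits every nonzero polynomial has slope 0, so its values could not keep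
  increasing.\<close>

lemma algebraic_type_pseudo_limits_nonempty:
  assumes "extends_to_ac v u" "algebraic_type v s"
  shows "pseudo_limits u s \<noteq> {}"
proof
  assume empty: "pseudo_limits u s = {}"
  interpret ss: equivalent_pair v s s
    by (rule equivalent_pair_refl)
  obtain f N where f: "\<And>n. n \<ge> N \<Longrightarrow> v (poly f (s n)) < v (poly f (s (Suc n)))"
    using assms(2) by (auto simp: algebraic_type_def)
  have "f \<noteq> 0"
    using f[of N] by auto
  then obtain c where "affine_along rgap c 0 (\<lambda>n. v (poly f (s n)))"
    using ss.poly_affine[OF assms(1)] empty by blast
  then obtain M where M: "\<And>n. n \<ge> M \<Longrightarrow> v (poly f (s n)) = ereal c"
    by (auto simp: affine_along_def eventually_sequentially)
  show False
    using f[of "max M N"] M[of "max M N"] M[of "Suc (max M N)"] by simp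
qed

lemma breadth_finite:
  assumes "breadth_ideal v s \<noteq> {0}"
  shows "breadth v s \<noteq> \<infinity>"
proof -
  \<comment> \<open>As 0 always belongs to the breadth ideal, differing from \<open>{0}\<close>
    means containing a nonzero element, whose finite value bounds the gaps.\<close>
  have "0 \<in> breadth_ideal v s"
    using gap_eq by (simp add: breadth_ideal_def gap_def)
  then obtain b where b: "b \<noteq> 0" "\<And>n. gap n < v b"
    using assms by (auto simp: breadth_ideal_def gap_def)
  then have "breadth v s \<le> v b"
    by (intro breadth_least) (simp add: less_imp_le)
  then show ?thesis
    using b(1) by (auto simp: v_eq_val)
qed

lemma breadth_not_minus_infinity: "breadth v s \<noteq> -\<infinity>"
  using gap_less_breadth[of 0] by auto

lemma affine_cases:
  assumes "breadth v s = \<infinity> \<Longrightarrow> d = 0"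
  obtains (flat) "d = 0"
  | (finite) "rgap \<longlonglongrightarrow> real_of_ereal (breadth v s)" "\<And>n. rgap n < real_of_ereal (breadth v s)"
proof (cases "breadth v s")
  case (real D)
  have "(\<lambda>n. ereal (rgap n)) \<longlonglongrightarrow> ereal D"
    using gap_tendsto real by (simp flip: gap_eq)
  then have "rgap \<longlonglongrightarrow> D"
    by simp
  moreover have "rgap n < D" for n
    using gap_less_breadth[of n] real by (simp add: gap_eq)
  ultimately show ?thesis
    using finite real by simp
qed (use assms flat breadth_not_minus_infinity in auto)

text \<open>For infinite breadth, \<open>real_of_ereal\<close> returns \<open>0\<close>, which is harmless since the slope vanishes.\<close>

lemma affine_tendsto:
  assumes "affine_along rgap c d w" "breadth v s = \<infinity> \<Longrightarrow> d = 0"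
  shows "w \<longlonglongrightarrow> ereal (c + d * real_of_ereal (breadth v s))"
proof -
  have "(\<lambda>n. c + d * rgap n) \<longlonglongrightarrow> c + d * real_of_ereal (breadth v s)"
    by (rule affine_cases[OF assms(2)]) (auto intro!: tendsto_intros)
  then have "(\<lambda>n. ereal (c + d * rgap n)) \<longlonglongrightarrow> ereal (c + d * real_of_ereal (breadth v s))"
    by simp
  then show ?thesis
    using assms(1) unfolding affine_along_def by (rule Lim_transform_eventually[OF _ eventually_mono]) auto
qed

text \<open>Only \<open>L = 0\<close> is delicate. Then either the slope is 0 or the values are
  \<open>- d\<close> times the positive difference of breadth and gap, so \<open>d\<close> decides
  the sign. Hence \<open>c\<close>, \<open>d\<close> and the breadth determine the answer.\<close>

lemma affine_eventually_nonneg_iff: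
  assumes "affine_along rgap c d w" "breadth v s = \<infinity> \<Longrightarrow> d = 0"
  defines "L \<equiv> c + d * real_of_ereal (breadth v s)"
  shows "(\<forall>\<^sub>F n in sequentially. 0 \<le> w n) \<longleftrightarrow> 0 < L \<or> L = 0 \<and> d \<le> 0"
proof -
  have lim: "w \<longlonglongrightarrow> ereal L"
    unfolding L_def using assms(1,2) by (rule affine_tendsto)
  consider "0 < L" | "L < 0" | "L = 0"
    by linarith
  then show ?thesis
  proof cases
    case 1
    then have "\<forall>\<^sub>F n in sequentially. 0 < w n"
      using lim order_tendstoD(1) by fastforce
    then show ?thesis
      using 1 by (auto elim: eventually_mono)
  next
    case 2
    then have neg: "\<forall>\<^sub>F n in sequentially. w n < 0"
      using lim order_tendstoD(2) by fastforce
    have "\<not> (\<forall>\<^sub>F n in sequentially. 0 \<le> w n)"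
    proof
      assume "\<forall>\<^sub>F n in sequentially. 0 \<le> w n"
      with neg have "\<forall>\<^sub>F n in sequentially. False"
        by eventually_elim auto
      then show False
        by simp
    qed
    then show ?thesis
      using 2 by simp
  next
    case 3
    have iff: "0 \<le> c + d * rgap n \<longleftrightarrow> d \<le> 0" for n
    proof (rule affine_cases[OF assms(2)])
      assume "d = 0"
      then show ?thesis
        using 3 by (simp add: L_def)
    next
      assume "\<And>n. rgap n < real_of_ereal (breadth v s)"
      then have less: "rgap n < real_of_ereal (breadth v s)" .
      have "c + d * rgap n = - d * (real_of_ereal (breadth v s) - rgap n)"
        using 3 by (simp add: L_def algebra_simps)
      then show ?thesis
        using less by (simp add: mult_le_0_iff)
    qed
    have "\<forall>\<^sub>F n in sequentially. 0 \<le> w n \<longleftrightarrow> d \<le> 0"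
      using assms(1) unfolding affine_along_def by eventually_elim (simp add: iff)
    then have "(\<forall>\<^sub>F n in sequentially. 0 \<le> w n) \<longleftrightarrow> (\<forall>\<^sub>F n in sequentially. d \<le> 0)"
      by (rule eventually_subst)
    then show ?thesis
      using 3 by simp
  qed
qed

end

section \<open>The limit valuation of an admissible sequence\<close>

locale admissible_seq = pseudo_convergent_seq v s
  for v :: "'a::field \<Rightarrow> ereal" and s +
  assumes rank_one: "rank_one_valuation v"
    and type: "transcendental_type v s \<or> algebraic_type v s \<and> breadth_ideal v s \<noteq> {0}"
begin

lemma infinite_breadth_imp_transcendental: "breadth v s = \<infinity> \<Longrightarrow> transcendental_type v s"
  using type breadth_finite by blast

abbreviation w :: "'a poly fract \<Rightarrow> ereal" where
  "w \<equiv> seq_valuation v s"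

lemma ratfun_tendsto:
  assumes "\<phi> \<noteq> 0"
  shows "\<exists>r. (\<lambda>n. v (ratfun_eval \<phi> (s n))) \<longlonglongrightarrow> ereal r \<and> w \<phi> = ereal r"
proof -
  interpret ss: equivalent_pair v s s
    by (rule equivalent_pair_refl)
  obtain c d where "affine_along rgap c d (\<lambda>n. v (ratfun_eval \<phi> (s n)))"
    "transcendental_type v s \<longrightarrow> d = 0"
    using ss.ratfun_affine[OF rank_one assms] by blast
  then have "(\<lambda>n. v (ratfun_eval \<phi> (s n))) \<longlonglongrightarrow> ereal (c + d * real_of_ereal (breadth v s))"
    using infinite_breadth_imp_transcendental by (intro affine_tendsto) auto
  moreover from limI[OF this] have "w \<phi> = ereal (c + d * real_of_ereal (breadth v s))"
    by (simp add: seq_valuation_def)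
  ultimately show ?thesis
    by blast
qed

lemma w_eqI: "(\<lambda>n. v (ratfun_eval \<phi> (s n))) \<longlonglongrightarrow> r \<Longrightarrow> w \<phi> = r"
  unfolding seq_valuation_def by (rule limI)

lemma ratfun_eval_0: "ratfun_eval 0 x = 0"
  using ratfun_eval_Fract[of 1 x 0] by (simp add: fract_collapse)

lemma w_0: "w 0 = \<infinity>"
  by (rule w_eqI) (simp add: ratfun_eval_0)

lemma w_const: "w (Fract [:a:] 1) = v a"
  by (rule w_eqI) (simp add: ratfun_eval_Fract)

lemma poly_eventually_nonzero:
  assumes "p \<noteq> 0"
  shows "\<forall>\<^sub>F n in sequentially. poly p (s n) \<noteq> 0"
proof -
  interpret ss: equivalent_pair v s s
    by (rule equivalent_pair_refl)
  obtain u where "extends_to_ac v u"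
    using extends_to_ac_exists[OF rank_one] by blast
  then obtain c d where "affine_along rgap c d (\<lambda>n. v (poly p (s n)))"
    using ss.poly_affine assms by blast
  then show ?thesis
    unfolding affine_along_def by eventually_elim auto
qed

lemma w_mult:
  assumes "\<phi> \<noteq> 0" "\<psi> \<noteq> 0"
  shows "w (\<phi> * \<psi>) = w \<phi> + w \<psi>"
proof -
  obtain p q where \<phi>: "\<phi> = Fract p q" "q \<noteq> 0"
    by (cases \<phi>) auto
  obtain p' q' where \<psi>: "\<psi> = Fract p' q'" "q' \<noteq> 0"
    by (cases \<psi>) auto
  obtain r where r: "(\<lambda>n. v (ratfun_eval \<phi> (s n))) \<longlonglongrightarrow> ereal r" "w \<phi> = ereal r"
    using ratfun_tendsto[OF assms(1)] by blast
  obtain r' where r': "(\<lambda>n. v (ratfun_eval \<psi> (s n))) \<longlonglongrightarrow> ereal r'" "w \<psi> = ereal r'"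
    using ratfun_tendsto[OF assms(2)] by blast
  have "(\<lambda>n. v (ratfun_eval \<phi> (s n)) + v (ratfun_eval \<psi> (s n))) \<longlonglongrightarrow> ereal r + ereal r'"
    using r(1) r'(1) by (intro tendsto_add_ereal) auto
  moreover have "\<forall>\<^sub>F n in sequentially. v (ratfun_eval \<phi> (s n)) + v (ratfun_eval \<psi> (s n))
      = v (ratfun_eval (\<phi> * \<psi>) (s n))"
    using poly_eventually_nonzero[OF \<phi>(2)] poly_eventually_nonzero[OF \<psi>(2)]
  proof eventually_elim
    case (elim n)
    then have "ratfun_eval (\<phi> * \<psi>) (s n) = ratfun_eval \<phi> (s n) * ratfun_eval \<psi> (s n)"
      by (simp add: \<phi>(1) \<psi>(1) ratfun_eval_Fract)
    then show ?case
      by (simp add: v_mult)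
  qed
  ultimately have "(\<lambda>n. v (ratfun_eval (\<phi> * \<psi>) (s n))) \<longlonglongrightarrow> ereal r + ereal r'"
    by (rule Lim_transform_eventually)
  then show ?thesis
    using w_eqI r(2) r'(2) by simp
qed

lemma w_power_mult_const:
  assumes "\<phi> \<noteq> 0" "b \<noteq> 0" "w \<phi> = ereal r"
  shows "w (\<phi> ^ n * Fract [:b:] 1) = ereal (real n * r + val b)"
proof (induction n)
  case 0
  then show ?case
    using assms by (simp add: w_const v_eq_val)
next
  case (Suc n)
  have "Fract [:b:] 1 \<noteq> 0"
    using assms by (simp add: Zero_fract_def eq_fract)
  then have "\<phi> ^ n * Fract [:b:] 1 \<noteq> 0"
    using assms by simp
  then show ?case
    using w_mult[OF assms(1), of "\<phi> ^ n * Fract [:b:] 1"] Suc assms(3)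
    by (simp add: algebra_simps)
qed

text \<open>The denominator is eventually nonzero, so poles do not matter in the long run.\<close>

lemma seq_domain_iff:
  "\<phi> \<in> seq_domain v s \<longleftrightarrow> (\<forall>\<^sub>F n in sequentially. 0 \<le> v (ratfun_eval \<phi> (s n)))"
proof -
  obtain p q where \<phi>: "\<phi> = Fract p q" "q \<noteq> 0"
    by (cases \<phi>) auto
  have "\<forall>\<^sub>F n in sequentially. defined_at \<phi> (s n)"
    using poly_eventually_nonzero[OF \<phi>(2)] by eventually_elim (use \<phi>(1) in \<open>auto simp: defined_at_def\<close>)
  then show ?thesis
    by (simp add: seq_domain_def valuation_domain_def cofinite_eq_sequentially eventually_conj_iff)
qed

lemma seq_domain_imp_w_nonneg:
  assumes "\<phi> \<in> seq_domain v s"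
  shows "0 \<le> w \<phi>"
proof (cases "\<phi> = 0")
  case False
  then obtain r where "(\<lambda>n. v (ratfun_eval \<phi> (s n))) \<longlonglongrightarrow> ereal r" "w \<phi> = ereal r"
    using ratfun_tendsto by blast
  then show ?thesis
    using assms tendsto_lowerbound[of _ "w \<phi>" sequentially 0] by (simp add: seq_domain_iff)
qed (simp add: w_0)

lemma w_pos_imp_seq_domain:
  assumes "0 < w \<phi>"
  shows "\<phi> \<in> seq_domain v s"
proof (cases "\<phi> = 0")
  case True
  then show ?thesis by (simp add: seq_domain_iff ratfun_eval_0)
next
  case False
  then obtain r where "(\<lambda>n. v (ratfun_eval \<phi> (s n))) \<longlonglongrightarrow> ereal r" "w \<phi> = ereal r"
    using ratfun_tendsto by blast
  then have "\<forall>\<^sub>F n in sequentially. 0 < v (ratfun_eval \<phi> (s n))"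
    using order_tendstoD(1) assms by fastforce
  then show ?thesis
    unfolding seq_domain_iff by (auto elim: eventually_mono)
qed

end

section \<open>Recovering the valuation and the equivalence\<close>

lemma (in valued_field) val_power_int:
  "a \<noteq> 0 \<Longrightarrow> val (a powi m) = of_int m * val a"
  by (simp add: power_int_def val_power val_inverse)

locale admissible_pair =
  E: admissible_seq v E + F: admissible_seq v F
  for v :: "'a::field \<Rightarrow> ereal" and E F
begin

sublocale pseudo_convergent_pair v E F ..

text \<open>If \<open>w\<^sub>E \<phi> < w\<^sub>F \<phi>\<close>, then \<open>b \<phi>\<^sup>n\<close> has negative value for \<open>w\<^sub>E\<close> and positive value for
  \<open>w\<^sub>F\<close>, for a suitable exponent \<open>n\<close> and a suitable power \<open>b\<close> of an element of positive value.\<close>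

lemma w_le:
  assumes pos: "\<And>\<psi>. 0 < F.w \<psi> \<Longrightarrow> 0 \<le> E.w \<psi>"
  shows "F.w \<phi> \<le> E.w \<phi>"
proof (cases "\<phi> = 0")
  case True
  then show ?thesis by (simp add: E.w_0)
next
  case False
  obtain x where x: "E.w \<phi> = ereal x"
    using E.ratfun_tendsto[OF False] by blast
  obtain y where y: "F.w \<phi> = ereal y"
    using F.ratfun_tendsto[OF False] by blast
  show ?thesis
  proof (rule ccontr)
    assume "\<not> F.w \<phi> \<le> E.w \<phi>"
    then have "x < y"
      using x y by simp
    obtain a where a: "a \<noteq> 0" "0 < E.val a"
      using rank_one_valuationE[OF E.rank_one] by (metis E.v_eq_val ereal_less(2) less_ereal.simps(1) zero_ereal_def)
    \<comment> \<open>Scaling by \<open>n\<close> makes the interval from \<open>n * x\<close> to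
      \<open>n * y\<close> longer than \<open>val a\<close>, so that a multiple of
      \<open>val a\<close> fits inside.\<close>
    obtain n where n: "E.val a < real n * (y - x)"
      using reals_Archimedean3[of "y - x"] \<open>x < y\<close> by auto
    \<comment> \<open>Floor plus 1 gives the first multiple strictly above \<open>n * x\<close>; the
      negative exponent in \<open>b\<close> then moves that multiple to 0.\<close>
    define m where "m = \<lfloor>real n * x / E.val a\<rfloor> + 1"
    have "real n * x / E.val a < of_int m" "of_int m \<le> real n * x / E.val a + 1"
      unfolding m_def by linarith+
    then have m: "real n * x < of_int m * E.val a" "of_int m * E.val a \<le> real n * x + E.val a"
      using a by (simp_all add: field_simps)
    define b where "b = a powi (- m)"
    have b: "b \<noteq> 0" "E.val b = - (of_int m * E.val a)"
      using a E.val_power_int[of a "- m"] by (simp_all add: b_def)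
    have "E.w (\<phi> ^ n * Fract [:b:] 1) < 0"
      using E.w_power_mult_const[OF False b(1) x, of n] b(2) m(1) by simp
    moreover have "0 < F.w (\<phi> ^ n * Fract [:b:] 1)"
      using F.w_power_mult_const[OF False b(1) y, of n] b(2) m(2) n by (simp add: algebra_simps)
    ultimately show False
      using pos by (meson not_le)
  qed
qed

text \<open>Both valuations are evaluated at X minus \<open>F j\<close>, whose value along
  \<open>F\<close> is eventually \<open>gap j\<close>.\<close>

lemma w_diff_tendsto:
  assumes "E.w = F.w"
  shows "(\<lambda>n. v (F j - E n)) \<longlonglongrightarrow> F.gap j"
proof -
  let ?X = "Fract [:- F j, 1:] 1"
  have eval: "ratfun_eval ?X x = x - F j" for x
    by (simp add: ratfun_eval_Fract)
  have "\<forall>\<^sub>F n in sequentially. v (ratfun_eval ?X (F n)) = F.gap j"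
    unfolding eventually_sequentially eval by (intro exI[of _ "Suc j"]) (simp add: F.v_diff)
  then have "F.w ?X = F.gap j"
    by (intro F.w_eqI tendsto_eventually)
  moreover have "?X \<noteq> 0"
    by (simp add: Zero_fract_def eq_fract)
  ultimately have "(\<lambda>n. v (ratfun_eval ?X (E n))) \<longlonglongrightarrow> F.gap j"
    using E.ratfun_tendsto assms by metis
  then show ?thesis
    by (simp add: eval E.v_diff_commute)
qed

lemma w_eq_imp_diff_eventually:
  assumes "E.w = F.w"
  shows "\<exists>N. \<forall>n\<ge>N. v (F j - E n) = F.gap j \<and> F.gap j < breadth v E"
proof -
  have lim: "(\<lambda>n. v (F j - E n)) \<longlonglongrightarrow> F.gap j" for j
    using w_diff_tendsto[OF assms] .
  have const: "\<exists>N. (\<forall>n\<ge>N. v (F j - E n) = F.gap j) \<and> F.gap j < breadth v E"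
    if not: "\<not> E.pseudo_limit (F j)" for j
  proof -
    obtain N where N: "\<And>n. n \<ge> N \<Longrightarrow> v (F j - E n) = v (F j - E N)" "v (F j - E N) < E.gap N"
      using E.not_pseudo_limitE[OF not] by blast
    have "\<forall>\<^sub>F n in sequentially. v (F j - E n) = v (F j - E N)"
      unfolding eventually_sequentially using N(1) by blast
    then have "(\<lambda>n. v (F j - E n)) \<longlonglongrightarrow> v (F j - E N)"
      by (rule tendsto_eventually)
    then have "v (F j - E N) = F.gap j"
      using lim by (rule LIMSEQ_unique)
    then show ?thesis
      using N E.gap_less_breadth[of N] by (metis less_trans)
  qed
  \<comment> \<open>Otherwise \<open>F.gap j\<close> is the breadth of \<open>E\<close>, and the
    next gap exceeds it. But \<open>F.gap (Suc j)\<close> equals this breadth if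
    \<open>F (Suc j)\<close> is a pseudo-limit of \<open>E\<close> and is smaller if not.\<close>
  have "\<not> E.pseudo_limit (F j)"
  proof
    assume "E.pseudo_limit (F j)"
    then have "breadth v E = F.gap j"
      using LIMSEQ_unique[OF E.pseudo_limit_diff_tendsto lim] by blast
    then have "breadth v E < F.gap (Suc j)"
      by (simp add: F.gap_Suc)
    then show False
      using const[of "Suc j"] LIMSEQ_unique[OF E.pseudo_limit_diff_tendsto lim, of "Suc j"] by fastforce
  qed
  then show ?thesis
    using const by blast
qed

lemma w_eq_imp_breadth_le:
  assumes "E.w = F.w"
  shows "breadth v F \<le> breadth v E"
  using w_eq_imp_diff_eventually[OF assms] by (intro F.breadth_least less_imp_le) blast

lemma w_eq_imp_equivalent:
  assumes w: "E.w = F.w"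
  shows "equivalent_seqs v E F"
proof -
  interpret swap: admissible_pair v F E
    by unfold_locales
  have "breadth v E = breadth v F"
    using w_eq_imp_breadth_le swap.w_eq_imp_breadth_le w by (simp add: antisym)
  moreover have "\<exists>i0 j0. \<forall>i\<ge>i0. \<forall>j\<ge>j0. F.gap k < v (E i - F j)" for k
  proof -
    \<comment> \<open>The term \<open>F (Suc k)\<close> is a bridge: its differences from late terms
      of either sequence have value \<open>F.gap (Suc k)\<close>, above
      \<open>F.gap k\<close>.\<close>
    obtain N where N: "\<And>n. n \<ge> N \<Longrightarrow> v (F (Suc k) - E n) = F.gap (Suc k)"
      using w_eq_imp_diff_eventually[OF w] by blast
    have "F.gap k < v (E i - F j)" if "i \<ge> N" "j \<ge> Suc (Suc k)" for i j
    proof (rule E.v_diff_trans_gt)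
      show "F.gap k < v (E i - F (Suc k))"
        using N[OF that(1)] F.gap_Suc[of k] E.v_diff_commute[of "E i"] by simp
      show "F.gap k < v (F (Suc k) - F j)"
        using that(2) F.v_diff[of "Suc k" j] F.gap_Suc[of k] E.v_diff_commute[of "F j"] by simp
    qed
    then show ?thesis
      by blast
  qed
  ultimately show ?thesis
    by (simp add: equivalent_seqs_def F.gap_def)
qed

lemma equivalent_imp_eq:
  assumes "equivalent_seqs v E F"
  shows "E.w = F.w" "seq_domain v E = seq_domain v F"
proof -
  interpret equivalent_pair v E F
    by unfold_locales (rule assms)
  have "E.w \<phi> = F.w \<phi> \<and> (\<phi> \<in> seq_domain v E \<longleftrightarrow> \<phi> \<in> seq_domain v F)" for \<phi>
  proof (cases "\<phi> = 0")
    case True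
    then show ?thesis
      by (simp add: E.w_0 F.w_0 E.seq_domain_iff F.seq_domain_iff E.ratfun_eval_0)
  next
    case False
    obtain c d where cd: "affine_along E.rgap c d (\<lambda>n. v (ratfun_eval \<phi> (E n)))"
      "affine_along F.rgap c d (\<lambda>n. v (ratfun_eval \<phi> (F n)))" "transcendental_type v E \<longrightarrow> d = 0"
      using ratfun_affine[OF E.rank_one False] by blast
    \<comment> \<open>Infinite breadth rules out a nonzero breadth ideal and leaves transcendental
      type, where the slope is 0.\<close>
    have d: "d = 0" if "breadth v E = \<infinity>"
      using that E.infinite_breadth_imp_transcendental cd(3) by blast
    have d': "d = 0" if "breadth v F = \<infinity>"
      using that d breadth_eq by simp
    show ?thesis
      using E.w_eqI[OF E.affine_tendsto[OF cd(1) d]] F.w_eqI[OF F.affine_tendsto[OF cd(2) d']]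
        E.affine_eventually_nonneg_iff[OF cd(1) d] F.affine_eventually_nonneg_iff[OF cd(2) d']
      by (simp add: breadth_eq E.seq_domain_iff F.seq_domain_iff)
  qed
  then show "E.w = F.w" "seq_domain v E = seq_domain v F"
    by blast+
qed

text \<open>The assumptions are weak enough to follow from equality of either kind of domain,
  \<open>seq_domain\<close> or \<open>seq_valuation_domain\<close>.\<close>

lemma sandwich_imp_equivalent:
  assumes "\<And>\<psi>. 0 < F.w \<psi> \<Longrightarrow> 0 \<le> E.w \<psi>" "\<And>\<psi>. 0 < E.w \<psi> \<Longrightarrow> 0 \<le> F.w \<psi>"
  shows "equivalent_seqs v E F"
proof -
  interpret swap: admissible_pair v F E
    by unfold_locales
  show ?thesis
    using w_le[OF assms(1)] swap.w_le[OF assms(2)] by (intro w_eq_imp_equivalent ext antisym)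
qed

lemma equivalent_iff_seq_domain: "equivalent_seqs v E F \<longleftrightarrow> seq_domain v E = seq_domain v F"
proof
  assume eq: "seq_domain v E = seq_domain v F"
  show "equivalent_seqs v E F"
    by (rule sandwich_imp_equivalent)
      (use eq E.w_pos_imp_seq_domain F.w_pos_imp_seq_domain E.seq_domain_imp_w_nonneg
        F.seq_domain_imp_w_nonneg in blast)+
qed (rule equivalent_imp_eq)

lemma equivalent_iff_w: "equivalent_seqs v E F \<longleftrightarrow> seq_valuation v E = seq_valuation v F"
  using equivalent_imp_eq w_eq_imp_equivalent by blast

lemma equivalent_iff_seq_valuation_domain:
  "equivalent_seqs v E F \<longleftrightarrow> seq_valuation_domain v E = seq_valuation_domain v F"
proof
  assume "equivalent_seqs v E F"
  then show "seq_valuation_domain v E = seq_valuation_domain v F"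
    by (simp add: equivalent_iff_w seq_valuation_domain_def)
next
  assume "seq_valuation_domain v E = seq_valuation_domain v F"
  then have "0 \<le> E.w \<psi> \<longleftrightarrow> 0 \<le> F.w \<psi>" for \<psi>
    by (auto simp: seq_valuation_domain_def)
  then show "equivalent_seqs v E F"
    using less_imp_le by (intro sandwich_imp_equivalent) blast+
qed

text \<open>Algebraic type provides the common pseudo-limit needed for the converse.\<close>

lemma equivalent_iff_pseudo_limits:
  assumes "algebraic_type v E" "extends_to_ac v u"
  shows "equivalent_seqs v E F \<longleftrightarrow> pseudo_limits u E = pseudo_limits u F"
proof
  assume "equivalent_seqs v E F"
  then interpret equivalent_pair v E F
    by unfold_locales
  show "pseudo_limits u E = pseudo_limits u F"
    by (rule pseudo_limits_eq) (rule assms(2))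
next
  assume "pseudo_limits u E = pseudo_limits u F"
  then show "equivalent_seqs v E F"
    using pseudo_limits_eq_imp_equivalent E.algebraic_type_pseudo_limits_nonempty assms by blast
qed

end

theorem theorem5p4:
  fixes v :: "'k::field \<Rightarrow> ereal" and E F :: "nat \<Rightarrow> 'k"
  assumes "rank_one_valuation v"
    and "pseudo_convergent v E"
    and "transcendental_type v E \<or> algebraic_type v E \<and> breadth_ideal v E \<noteq> {0}"
    and "pseudo_convergent v F"
    and "transcendental_type v F \<or> algebraic_type v F \<and> breadth_ideal v F \<noteq> {0}"
  shows "(equivalent_seqs v E F \<longleftrightarrow> seq_domain v E = seq_domain v F) \<and>
         (equivalent_seqs v E F \<longleftrightarrow> seq_valuation_domain v E = seq_valuation_domain v F) \<and>
         (equivalent_seqs v E F \<longleftrightarrow> seq_valuation v E = seq_valuation v F) \<and>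
         (algebraic_type v E \<and> algebraic_type v F \<longrightarrow>
           (equivalent_seqs v E F \<longleftrightarrow>
             (\<forall>u. extends_to_ac v u \<longrightarrow> pseudo_limits u E = pseudo_limits u F)) \<and>
           (equivalent_seqs v E F \<longleftrightarrow>
             (\<exists>u. extends_to_ac v u \<and> pseudo_limits u E = pseudo_limits u F)))"
proof -
  interpret admissible_pair v E F
    using assms by unfold_locales (auto simp: rank_one_valuation_def)
  \<comment> \<open>Existence of an extension keeps the universal condition from being vacuous, so
    that it implies the existential one.\<close>
  obtain u where "extends_to_ac v u"
    using extends_to_ac_exists[OF assms(1)] by blast
  then show ?thesis
    using equivalent_iff_seq_domain equivalent_iff_seq_valuation_domain equivalent_iff_w
      equivalent_iff_pseudo_limits by blast
qed

end
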